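(* Let $F=\langle x,y\rangle$ be the free nilpotent group of rank two and class three, freely generated (as such) by $x$ and $y$, and let $p$ be a prime greater than three. For $r=1,\ldots,p-1$ let \[ N_r=\langle x^{p^2},\, y^p,\, x^{-rp}[y,x,x],\, [y,x,y]\rangle^F \] be the normal closure in $F$ of the four listed elements. Then: (1) for each $r\in\{1,\ldots,p-1\}$, the quotient $F/N_r$ is a $p$-group of order $p^4$, nilpotency class three and exponent $p^2$; (2) all the quotients $F/N_r$, for $r\in\{1,\ldots,p-1\}$, are isomorphic to one another; (3) for $r,s\in\{1,\ldots,p-1\}$, the subgroups $N_r$ and $N_s$ belong to the same orbit under the action of $\operatorname{Aut}(F)$ on the subgroups of $F$ if and only if $r=s$ or $r=p-s$.
   Context: The free nilpotent group of rank two and class three on $x,y$ is the quotient of the free group on $x,y$ by the fourth term $\gamma_4$ of its lower central series (where $\gamma_1$ is the whole group). Commutators are $[a,b]=a^{-1}b^{-1}ab$, and longer commutators are left-normed: $[a,b,c]=[[a,b],c]$. For a subset $S$ of $F$, $\langle S\rangle^F$ denotes the normal closure of $S$ in $F$, i.e. the smallest normal subgroup of $F$ containing $S$. *)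

theory Defs
  imports "HOL-Algebra.Algebra"
begin

section \<open>Commutators, lower central series, normal closure\<close>

definition commutator :: "('a, 'm) monoid_scheme \<Rightarrow> 'a \<Rightarrow> 'a \<Rightarrow> 'a" where
  "commutator G a b = inv\<^bsub>G\<^esub> a \<otimes>\<^bsub>G\<^esub> inv\<^bsub>G\<^esub> b \<otimes>\<^bsub>G\<^esub> a \<otimes>\<^bsub>G\<^esub> b"

definition commutator_subgroup :: "('a, 'm) monoid_scheme \<Rightarrow> 'a set \<Rightarrow> 'a set \<Rightarrow> 'a set" where
  "commutator_subgroup G H K = generate G {commutator G h k | h k. h \<in> H \<and> k \<in> K}"

text \<open>Indexed from 1, so that term 1 is the whole group (the junk term 0 is the whole group, too).\<close>

definition lower_central :: "('a, 'm) monoid_scheme \<Rightarrow> nat \<Rightarrow> 'a set" where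
  "lower_central G n = ((\<lambda>H. commutator_subgroup G H (carrier G)) ^^ (n - 1)) (carrier G)"

definition has_nilpotency_class :: "('a, 'm) monoid_scheme \<Rightarrow> nat \<Rightarrow> bool" where
  "has_nilpotency_class G c \<longleftrightarrow>
     lower_central G (c + 1) = {\<one>\<^bsub>G\<^esub>} \<and> (\<forall>d<c. lower_central G (d + 1) \<noteq> {\<one>\<^bsub>G\<^esub>})"

definition has_exponent :: "('a, 'm) monoid_scheme \<Rightarrow> nat \<Rightarrow> bool" where
  "has_exponent G n \<longleftrightarrow>
     0 < n \<and> (\<forall>g\<in>carrier G. g [^]\<^bsub>G\<^esub> n = \<one>\<^bsub>G\<^esub>) \<and>
     (\<forall>m. 0 < m \<and> m < n \<longrightarrow> (\<exists>g\<in>carrier G. g [^]\<^bsub>G\<^esub> m \<noteq> \<one>\<^bsub>G\<^esub>))"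

definition p_group :: "nat \<Rightarrow> ('a, 'm) monoid_scheme \<Rightarrow> bool" where
  "p_group p G \<longleftrightarrow> group G \<and> (\<forall>g\<in>carrier G. \<exists>k. group.ord G g = p ^ k)"

definition normal_closure :: "('a, 'm) monoid_scheme \<Rightarrow> 'a set \<Rightarrow> 'a set" where
  "normal_closure G S = \<Inter> {H. H \<lhd> G \<and> S \<subseteq> H}"

text \<open>Restricted to the set of subgroups, as required by the locale \<^locale>\<open>group_action\<close>.\<close>

definition aut_action :: "('a, 'm) monoid_scheme \<Rightarrow> ('a \<Rightarrow> 'a) \<Rightarrow> 'a set \<Rightarrow> 'a set" where
  "aut_action G \<phi> = (\<lambda>H\<in>{H. subgroup H G}. \<phi> ` H)"

section \<open>Free groups\<close>

text \<open>
  The letter \<open>(a, True)\<close> stands for the generator \<open>a\<close> and \<open>(a, False)\<close> for its inverse.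
  The elements of the free group are the reduced words; the product is concatenation
  followed by free reduction.
\<close>

definition inv_letter :: "'a \<times> bool \<Rightarrow> 'a \<times> bool" where
  "inv_letter l = (fst l, \<not> snd l)"

definition reduced :: "('a \<times> bool) list \<Rightarrow> bool" where
  "reduced w \<longleftrightarrow> successively (\<lambda>l m. m \<noteq> inv_letter l) w"

fun red_cons :: "'a \<times> bool \<Rightarrow> ('a \<times> bool) list \<Rightarrow> ('a \<times> bool) list" where
  "red_cons l [] = [l]"
| "red_cons l (m # w) = (if m = inv_letter l then w else l # m # w)"

definition free_group :: "'a set \<Rightarrow> ('a \<times> bool) list monoid" where
  "free_group S =
     \<lparr>carrier = {w. reduced w \<and> fst ` set w \<subseteq> S}, monoid.mult = foldr red_cons, one = []\<rparr>"

lemma inv_letter_simps [simp]: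
  "inv_letter (inv_letter l) = l" "fst (inv_letter l) = fst l" "inv_letter l \<noteq> l"
  "inv_letter l = inv_letter m \<longleftrightarrow> l = m"
  by (cases l; cases m; auto simp: inv_letter_def)+

lemma reduced_Cons:
  "reduced (l # w) \<longleftrightarrow> reduced w \<and> (w = [] \<or> hd w \<noteq> inv_letter l)"
  by (cases w) (auto simp: reduced_def)

lemma reduced_Nil [simp]: "reduced []"
  by (simp add: reduced_def)

lemma reduced_red_cons: "reduced w \<Longrightarrow> reduced (red_cons l w)"
  by (cases w) (auto simp: reduced_Cons)

lemma reduced_foldr: "reduced v \<Longrightarrow> reduced (foldr red_cons u v)"
  by (induction u) (auto intro: reduced_red_cons)

lemma red_cons_cancel: "reduced w \<Longrightarrow> red_cons l (red_cons (inv_letter l) w) = w"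
proof (cases w)
  case (Cons m v)
  then show "reduced w \<Longrightarrow> ?thesis" by (cases v) (auto simp: reduced_Cons)
qed simp

lemma foldr_red_cons_red_cons:
  assumes "reduced w"
  shows "foldr red_cons (red_cons l v) w = red_cons l (foldr red_cons v w)"
  using red_cons_cancel[OF reduced_foldr[OF assms]] by (cases v) auto

lemma foldr_red_cons_assoc:
  "reduced w \<Longrightarrow>
     foldr red_cons (foldr red_cons u v) w = foldr red_cons u (foldr red_cons v w)"
  by (induction u) (auto simp: foldr_red_cons_red_cons)

lemma set_red_cons: "set (red_cons l w) \<subseteq> insert l (set w)"
  by (cases w) auto

lemma set_foldr_red_cons: "set (foldr red_cons u v) \<subseteq> set u \<union> set v"
proof (induction u)
  case (Cons l u)
  then show ?case using set_red_cons[of l "foldr red_cons u v"] by (simp del: split_paired_All) blast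
qed simp

lemma foldr_red_cons_Nil: "reduced w \<Longrightarrow> foldr red_cons w [] = w"
proof (induction w)
  case (Cons l w)
  then show ?case by (cases w) (auto simp: reduced_Cons)
qed simp

lemma foldr_red_cons_inverse:
  "reduced v \<Longrightarrow> foldr red_cons (rev (map inv_letter w)) (foldr red_cons w v) = v"
proof (induction w arbitrary: v)
  case (Cons l w)
  then show ?case
    using red_cons_cancel[of "foldr red_cons w v" "inv_letter l"] by (simp add: reduced_foldr)
qed simp

lemma group_free_group: "group (free_group S)"
proof (rule groupI)
  fix u v assume "u \<in> carrier (free_group S)" "v \<in> carrier (free_group S)"
  then show "u \<otimes>\<^bsub>free_group S\<^esub> v \<in> carrier (free_group S)"
    using image_mono[OF set_foldr_red_cons, of fst u v]
    by (simp add: free_group_def reduced_foldr image_Un) blast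
next
  fix u assume u: "u \<in> carrier (free_group S)"
  let ?v = "foldr red_cons (rev (map inv_letter u)) []"
  have "set ?v \<subseteq> inv_letter ` set u"
    using set_foldr_red_cons[of "rev (map inv_letter u)" "[]"] by simp
  then have "?v \<in> carrier (free_group S)"
    using u by (force simp: free_group_def reduced_foldr)
  moreover have "?v \<otimes>\<^bsub>free_group S\<^esub> u = \<one>\<^bsub>free_group S\<^esub>"
    using u foldr_red_cons_inverse[of "[]" u]
    by (simp add: free_group_def foldr_red_cons_assoc foldr_red_cons_Nil)
  ultimately show "\<exists>v\<in>carrier (free_group S). v \<otimes>\<^bsub>free_group S\<^esub> u = \<one>\<^bsub>free_group S\<^esub>" ..
qed (auto simp: free_group_def foldr_red_cons_assoc)

section \<open>Free nilpotent groups\<close>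

definition free_nilpotent_group :: "'a set \<Rightarrow> nat \<Rightarrow> ('a \<times> bool) list set monoid" where
  "free_nilpotent_group S c = free_group S Mod lower_central (free_group S) (c + 1)"

definition free_nilpotent_gen :: "'a set \<Rightarrow> nat \<Rightarrow> 'a \<Rightarrow> ('a \<times> bool) list set" where
  "free_nilpotent_gen S c a =
     lower_central (free_group S) (c + 1) #>\<^bsub>free_group S\<^esub> [(a, True)]"

section \<open>The normal subgroups\<close>

definition N_sub :: "('a, 'm) monoid_scheme \<Rightarrow> 'a \<Rightarrow> 'a \<Rightarrow> nat \<Rightarrow> nat \<Rightarrow> 'a set" where
  "N_sub F x y p r = normal_closure F
     {x [^]\<^bsub>F\<^esub> (p ^ 2),
      y [^]\<^bsub>F\<^esub> p,
      x [^]\<^bsub>F\<^esub> (- int (r * p)) \<otimes>\<^bsub>F\<^esub> commutator F (commutator F y x) x,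
      commutator F (commutator F y x) y}"

end

theory Submission
  imports Defs
begin

text \<open>
  All computations are transported to one concrete group of integer
  quadruples: the semidirect product of \<open>\<int>\<close> with the integer polynomials
  \<open>a T\<^sup>2 + b T + c\<close>, in which the generator of \<open>\<int>\<close> acts by \<open>T \<mapsto> T + 1\<close>.
  It has class three, so there is a homomorphism \<open>e\<close> from \<open>F\<close> that sends \<open>x\<close> to the
  shift and \<open>y\<close> to \<open>T\<^sup>2\<close>. Commutation with the shift is the difference operator, hence
  \<open>[y, x]\<close> goes to \<open>2 T + 1\<close>, \<open>[y, x, x]\<close> to the constant \<open>2\<close>, and
  \<open>[y, x, y]\<close> to \<open>0\<close>.

  The key fact is \<open>mem_N_iff\<close>: the subgroup \<open>N r\<close> is the full preimage under \<open>e\<close> of the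
  normal subgroup \<open>relator_subgroup p r\<close> given by the divisibilities \<open>p dvd a\<close>, \<open>p dvd b\<close>,
  \<open>p\<^sup>2 dvd 2 i + r p c\<close>. That \<open>N r\<close> is contained in the preimage only needs the images of
  the four relators. For the converse, collection in \<open>F Mod N r\<close> (\<open>normal_form\<close>) shows that
  every coset contains a word \<open>x\<^sup>i y\<^sup>j [y, x]\<^sup>k\<close> with \<open>i < p\<^sup>2\<close> and \<open>j, k < p\<close>, and the
  divisibilities tell all these words apart. So the quotient has order \<open>p\<^sup>4\<close>, and every
  further question about \<open>N r\<close> is one about integers.

  Class: \<open>[y, x, x]\<close> is not in \<open>N r\<close>, as \<open>p\<close> does not divide \<open>r\<close>. Exponent: the
  \<open>p\<close>-th power of a quadruple involves the sums of \<open>t\<close> and of \<open>t\<^sup>2\<close> over \<open>t < p\<close>,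
  which are divisible by \<open>p\<close> because \<open>p > 3\<close>. Isomorphism: the endomorphism fixing \<open>x\<close>
  and sending \<open>y\<close> to \<open>y\<^sup>n\<close> multiplies the polynomial part by \<open>n\<close>, so it pulls \<open>N s\<close>
  back to \<open>N r\<close> as soon as \<open>r\<close> is congruent to \<open>s n\<close> modulo \<open>p\<close>
  (\<open>endo_scale\<close>); for given \<open>r\<close> and \<open>s\<close> such an \<open>n\<close> exists, and the induced injection
  between quotients of equal order is an isomorphism.

  That endomorphism is an automorphism for \<open>n = - 1\<close>, which puts \<open>N r\<close> and \<open>N (p - r)\<close>
  in the same orbit. Nothing else is possible, because an automorphism acts on the abelianisation
  \<open>\<int>\<^sup>2\<close> with determinant \<open>\<delta>\<close> equal to \<open>1\<close> or \<open>- 1\<close> (\<open>iso_det\<close>). If it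
  carries \<open>N r\<close> to \<open>N s\<close>, the relator \<open>y\<^sup>p\<close> forces the \<open>x\<close>-exponent of the image of
  \<open>y\<close> to be divisible by \<open>p\<close>, and the third relator then gives \<open>p dvd s \<delta> - r\<close>
  (\<open>same_orbit_imp\<close>).
\<close>

section \<open>Commutators and the lower central series\<close>

lemma (in group) commutator_closed [simp]:
  "\<lbrakk>a \<in> carrier G; b \<in> carrier G\<rbrakk> \<Longrightarrow> commutator G a b \<in> carrier G"
  by (simp add: commutator_def)

lemma (in group) mult_inv_cancel_left:
  assumes "a \<in> carrier G" "b \<in> carrier G"
  shows "a \<otimes> (inv a \<otimes> b) = b" "inv a \<otimes> (a \<otimes> b) = b"
  using assms by (simp_all add: m_assoc[symmetric])

lemma (in group) mult_commutator:
  assumes "a \<in> carrier G" "b \<in> carrier G"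
  shows "b \<otimes> a \<otimes> commutator G a b = a \<otimes> b"
  using assms by (simp add: commutator_def m_assoc mult_inv_cancel_left)

lemma (in group) commutator_eq_iff:
  assumes "a \<in> carrier G" "b \<in> carrier G" "c \<in> carrier G"
  shows "commutator G a b = c \<longleftrightarrow> a \<otimes> b = b \<otimes> a \<otimes> c"
  using assms mult_commutator[of a b] l_cancel[of "b \<otimes> a" "commutator G a b" c]
  by auto

lemma (in group_hom) hom_commutator:
  assumes "a \<in> carrier G" "b \<in> carrier G"
  shows "h (commutator G a b) = commutator H (h a) (h b)"
  using assms by (simp add: commutator_def)

lemma (in group) commutator_set_in_carrier:
  assumes "A \<subseteq> carrier G" "B \<subseteq> carrier G"
  shows "{commutator G a b | a b. a \<in> A \<and> b \<in> B} \<subseteq> carrier G"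
  using assms by (auto intro!: commutator_closed)

lemma (in group) commutator_subgroup_is_subgroup:
  assumes "A \<subseteq> carrier G" "B \<subseteq> carrier G"
  shows "subgroup (commutator_subgroup G A B) G"
  unfolding commutator_subgroup_def
  using generate_is_subgroup[OF commutator_set_in_carrier[OF assms]] .

lemma (in group) commutator_subgroup_mono:
  assumes "A \<subseteq> A'" "B \<subseteq> B'"
  shows "commutator_subgroup G A B \<subseteq> commutator_subgroup G A' B'"
  unfolding commutator_subgroup_def by (rule mono_generate) (use assms in blast)

lemma (in group_hom) commutator_subgroup_img:
  assumes "A \<subseteq> carrier G" "B \<subseteq> carrier G"
  shows "h ` commutator_subgroup G A B = commutator_subgroup H (h ` A) (h ` B)"
proof -
  have "h ` {commutator G a b | a b. a \<in> A \<and> b \<in> B}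
      = {commutator H a b | a b. a \<in> h ` A \<and> b \<in> h ` B}"
  proof -
    have "h (commutator G a b) = commutator H (h a) (h b)" if "a \<in> A" "b \<in> B" for a b
      using that assms hom_commutator by blast
    then show ?thesis by (auto simp: image_iff) metis+
  qed
  then show ?thesis
    using generate_img[OF G.commutator_set_in_carrier[OF assms]]
    by (simp add: commutator_subgroup_def)
qed

lemma lower_central_1: "lower_central G (Suc 0) = carrier G"
  by (simp add: lower_central_def)

lemma lower_central_Suc_Suc:
  "lower_central G (Suc (Suc n)) = commutator_subgroup G (lower_central G (Suc n)) (carrier G)"
  by (simp add: lower_central_def)

lemma (in group) lower_central_subgroup: "subgroup (lower_central G (Suc n)) G"
proof (induction n)
  case 0
  show ?case by (simp add: lower_central_1 subgroup_self)
next
  case (Suc n)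
  then show ?case
    by (simp add: lower_central_Suc_Suc commutator_subgroup_is_subgroup subgroup.subset)
qed

lemma (in group) commutator_in_lower_central:
  assumes "a \<in> lower_central G (Suc n)" "b \<in> carrier G"
  shows "commutator G a b \<in> lower_central G (Suc (Suc n))"
  unfolding lower_central_Suc_Suc commutator_subgroup_def
  using assms by (blast intro: generate.incl)

lemma (in group_hom) lower_central_img_subset:
  "h ` lower_central G (Suc n) \<subseteq> lower_central H (Suc n)"
proof (induction n)
  case 0
  show ?case by (auto simp: lower_central_1)
next
  case (Suc n)
  have "h ` lower_central G (Suc (Suc n))
      = commutator_subgroup H (h ` lower_central G (Suc n)) (h ` carrier G)"
    by (simp add: lower_central_Suc_Suc commutator_subgroup_img
        G.lower_central_subgroup[THEN subgroup.subset])
  also have "\<dots> \<subseteq> lower_central H (Suc (Suc n))"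
    unfolding lower_central_Suc_Suc
    by (rule H.commutator_subgroup_mono) (use Suc in auto)
  finally show ?case .
qed

lemma (in group_hom) lower_central_img:
  assumes "h ` carrier G = carrier H"
  shows "h ` lower_central G (Suc n) = lower_central H (Suc n)"
proof (induction n)
  case 0
  show ?case using assms by (simp add: lower_central_1)
next
  case (Suc n)
  then show ?case using assms
    by (simp add: lower_central_Suc_Suc commutator_subgroup_img
        G.lower_central_subgroup[THEN subgroup.subset])
qed

text \<open>Conjugations are surjective endomorphisms, and those map each term onto itself.\<close>
lemma (in group) lower_central_normal: "lower_central G (Suc n) \<lhd> G"
proof (rule normal_invI[OF lower_central_subgroup])
  fix g h assume g: "g \<in> carrier G" and h: "h \<in> lower_central G (Suc n)"
  let ?c = "\<lambda>u. g \<otimes> u \<otimes> inv g"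
  have "?c \<in> hom G G"
  proof (rule homI)
    fix u v assume "u \<in> carrier G" "v \<in> carrier G"
    then show "?c (u \<otimes> v) = ?c u \<otimes> ?c v"
      using g by (simp add: m_assoc inv_solve_left)
  qed (use g in auto)
  then interpret c: group_hom G G ?c
    by unfold_locales
  show "?c h \<in> lower_central G (Suc n)"
    using c.lower_central_img_subset h by auto
qed

section \<open>Homomorphisms on free nilpotent groups\<close>

lemma hom_eq_on_generate:
  assumes "group_hom G H h" "group_hom G H k" "A \<subseteq> carrier G"
    and "\<And>a. a \<in> A \<Longrightarrow> h a = k a" and "g \<in> generate G A"
  shows "h g = k g"
proof -
  interpret h: group_hom G H h by fact
  interpret k: group_hom G H k by fact
  show ?thesis using assms(5)
  proof (induction g rule: generate.induct)
    case (eng u v)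
    then show ?case
      using h.G.generate_in_carrier[OF assms(3)] by simp
  qed (use assms(3,4) in auto)
qed

text \<open>Words are evaluated as lists of letters, reduced or not, so that the homomorphism property
  reduces to compatibility with the prefixing of a single letter.\<close>
definition letter_value :: "('b, 'm) monoid_scheme \<Rightarrow> ('a \<Rightarrow> 'b) \<Rightarrow> 'a \<times> bool \<Rightarrow> 'b" where
  "letter_value H f l = (if snd l then f (fst l) else inv\<^bsub>H\<^esub> f (fst l))"

definition word_value :: "('b, 'm) monoid_scheme \<Rightarrow> ('a \<Rightarrow> 'b) \<Rightarrow> ('a \<times> bool) list \<Rightarrow> 'b" where
  "word_value H f w = foldr (\<lambda>l u. letter_value H f l \<otimes>\<^bsub>H\<^esub> u) w \<one>\<^bsub>H\<^esub>"

context group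
begin

context
  fixes f :: "'s \<Rightarrow> 'a" and S :: "'s set"
  assumes f: "f ` S \<subseteq> carrier G"
begin

lemma letter_value_closed: "fst l \<in> S \<Longrightarrow> letter_value G f l \<in> carrier G"
  using f by (auto simp: letter_value_def)

lemma word_value_closed: "fst ` set w \<subseteq> S \<Longrightarrow> word_value G f w \<in> carrier G"
  by (induction w) (auto simp: word_value_def letter_value_closed)

lemma letter_value_inv_letter:
  "fst l \<in> S \<Longrightarrow> letter_value G f l \<otimes> letter_value G f (inv_letter l) = \<one>"
  using f by (auto simp: letter_value_def inv_letter_def)

lemma word_value_red_cons:
  assumes "fst l \<in> S" "fst ` set w \<subseteq> S"
  shows "word_value G f (red_cons l w) = letter_value G f l \<otimes> word_value G f w"
proof (cases w)
  case (Cons m v)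
  have "letter_value G f l \<otimes> (letter_value G f (inv_letter l) \<otimes> word_value G f v)
      = word_value G f v" if "m = inv_letter l"
    using assms Cons that
    by (simp add: m_assoc[symmetric] letter_value_inv_letter letter_value_closed word_value_closed)
  then show ?thesis
    using Cons by (auto simp: word_value_def)
qed (simp add: word_value_def)

lemma word_value_hom: "word_value G f \<in> hom (free_group S) G"
proof (rule homI)
  fix u assume "u \<in> carrier (free_group S)"
  then show "word_value G f u \<in> carrier G"
    by (simp add: free_group_def word_value_closed)
next
  fix u v assume "u \<in> carrier (free_group S)" "v \<in> carrier (free_group S)"
  then have u: "fst ` set u \<subseteq> S" and v: "fst ` set v \<subseteq> S"
    by (auto simp: free_group_def)
  from u have "word_value G f (foldr red_cons u v) = word_value G f u \<otimes> word_value G f v"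
  proof (induction u)
    case Nil
    then show ?case using v by (simp add: word_value_def word_value_closed[unfolded word_value_def])
  next
    case (Cons l u)
    have "fst ` set (foldr red_cons u v) \<subseteq> S"
      using set_foldr_red_cons[of u v] Cons.prems v by fastforce
    moreover have "word_value G f (l # u) = letter_value G f l \<otimes> word_value G f u"
      by (simp add: word_value_def)
    ultimately show ?case
      using Cons v
      by (simp add: word_value_red_cons letter_value_closed word_value_closed m_assoc)
  qed
  then show "word_value G f (u \<otimes>\<^bsub>free_group S\<^esub> v) = word_value G f u \<otimes> word_value G f v"
    by (simp add: free_group_def)
qed

end

end

text \<open>A reduced word is the product of its letters without any cancellation.\<close>
lemma free_group_generated:
  assumes "w \<in> carrier (free_group S)"
  shows "w \<in> generate (free_group S) ((\<lambda>a. [(a, True)]) ` S)"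
proof -
  interpret FG: group "free_group S" by (rule group_free_group)
  let ?A = "(\<lambda>a. [(a, True)]) ` S"
  have carr: "[(a, e)] \<in> carrier (free_group S)" if "a \<in> S" for a e
    using that by (simp add: free_group_def reduced_def)
  have inv: "inv\<^bsub>free_group S\<^esub> [(a, True)] = [(a, False)]" if "a \<in> S" for a
    by (rule FG.inv_equality)
      (use that carr in \<open>auto simp: free_group_def inv_letter_def\<close>)
  have letter: "[l] \<in> generate (free_group S) ?A" if "fst l \<in> S" for l
  proof (cases l)
    case (Pair a e)
    with that inv[of a] show ?thesis
      using generate.incl[of "[(a, True)]" ?A] generate.inv[of "[(a, True)]" ?A "free_group S"]
      by (cases e) auto
  qed
  have "reduced w" "fst ` set w \<subseteq> S" using assms by (auto simp: free_group_def)
  then show ?thesis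
  proof (induction w)
    case Nil
    show ?case using generate.one[of "free_group S" ?A] by (simp add: free_group_def)
  next
    case (Cons l w)
    have "l # w = [l] \<otimes>\<^bsub>free_group S\<^esub> w"
      using Cons.prems by (cases w) (auto simp: free_group_def reduced_Cons)
    moreover have "[l] \<in> generate (free_group S) ?A" "w \<in> generate (free_group S) ?A"
      using Cons letter by (auto simp: reduced_Cons)
    ultimately show ?case using generate.eng by metis
  qed
qed

context
  fixes S :: "'a set" and c :: nat
begin

interpretation FG: group "free_group S" by (rule group_free_group)
interpretation lcn: normal "lower_central (free_group S) (Suc c)" "free_group S"
  by (rule FG.lower_central_normal)

lemma free_nilpotent_group_is_group: "group (free_nilpotent_group S c)"
  using lcn.factorgroup_is_group by (simp add: free_nilpotent_group_def)

lemma free_nilpotent_proj: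
  "group_hom (free_group S) (free_nilpotent_group S c)
     (\<lambda>w. lower_central (free_group S) (Suc c) #>\<^bsub>free_group S\<^esub> w)"
  using lcn.r_coset_hom_Mod free_nilpotent_group_is_group
  by (simp add: group_hom_def group_hom_axioms_def FG.is_group free_nilpotent_group_def)

lemma free_nilpotent_gen_closed:
  "a \<in> S \<Longrightarrow> free_nilpotent_gen S c a \<in> carrier (free_nilpotent_group S c)"
  by (auto simp: free_nilpotent_gen_def free_nilpotent_group_def carrier_FactGroup free_group_def
      reduced_def)

lemma free_nilpotent_proj_surj:
  "(\<lambda>w. lower_central (free_group S) (Suc c) #>\<^bsub>free_group S\<^esub> w) ` carrier (free_group S)
    = carrier (free_nilpotent_group S c)"
  by (simp add: free_nilpotent_group_def carrier_FactGroup)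

lemma free_nilpotent_generated:
  "generate (free_nilpotent_group S c) (free_nilpotent_gen S c ` S)
    = carrier (free_nilpotent_group S c)"
proof -
  interpret q: group_hom "free_group S" "free_nilpotent_group S c"
    "\<lambda>w. lower_central (free_group S) (Suc c) #>\<^bsub>free_group S\<^esub> w"
    by (rule free_nilpotent_proj)
  let ?A = "(\<lambda>a. [(a, True)]) ` S"
  have A: "?A \<subseteq> carrier (free_group S)" by (auto simp: free_group_def reduced_def)
  have "generate (free_group S) ?A = carrier (free_group S)"
    using free_group_generated FG.generate_incl[OF A] by blast
  then show ?thesis
    using q.generate_img[OF A] free_nilpotent_proj_surj
    by (simp add: image_image free_nilpotent_gen_def)
qed

lemma free_nilpotent_class:
  "lower_central (free_nilpotent_group S c) (Suc c) = {\<one>\<^bsub>free_nilpotent_group S c\<^esub>}"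
proof -
  interpret q: group_hom "free_group S" "free_nilpotent_group S c"
    "\<lambda>w. lower_central (free_group S) (Suc c) #>\<^bsub>free_group S\<^esub> w"
    by (rule free_nilpotent_proj)
  let ?L = "lower_central (free_group S) (Suc c)"
  have "(\<lambda>w. ?L #>\<^bsub>free_group S\<^esub> w) ` ?L = (\<lambda>w. ?L) ` ?L"
    by (rule image_cong) (simp_all add: lcn.rcos_const FG.is_group)
  also have "\<dots> = {?L}"
    using subgroup.one_closed[OF lcn.is_subgroup] by blast
  finally have "(\<lambda>w. ?L #>\<^bsub>free_group S\<^esub> w) ` ?L = {?L}" .
  then show ?thesis
    using q.lower_central_img[OF free_nilpotent_proj_surj, of c]
    by (simp add: free_nilpotent_group_def)
qed

text \<open>A homomorphism from the free group to a group of class at most \<open>c\<close> kills the next term of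
  the lower central series.\<close>
lemma free_nilpotent_universal:
  assumes H: "group H" and nilp: "lower_central H (Suc c) = {\<one>\<^bsub>H\<^esub>}" and f: "f ` S \<subseteq> carrier H"
  obtains h where "h \<in> hom (free_nilpotent_group S c) H"
    and "\<And>a. a \<in> S \<Longrightarrow> h (free_nilpotent_gen S c a) = f a"
proof -
  interpret H: group H by (rule H)
  interpret w: group_hom "free_group S" H "word_value H f"
    using group.word_value_hom[OF H f]
    by (simp add: group_hom_def group_hom_axioms_def FG.is_group H.is_group)
  have "lower_central (free_group S) (Suc c) \<subseteq> kernel (free_group S) H (word_value H f)"
    using w.lower_central_img_subset[of c] nilp subgroup.subset[OF lcn.is_subgroup]
    by (auto simp: kernel_def)
  then obtain h where h: "h \<in> hom (free_group S Mod lower_central (free_group S) (Suc c)) H"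
    and hv: "\<And>u. u \<in> carrier (free_group S) \<Longrightarrow>
      h (lower_central (free_group S) (Suc c) #>\<^bsub>free_group S\<^esub> u) = word_value H f u"
    using w.FactGroup_universal_kernel[OF FG.lower_central_normal] by blast
  show thesis
  proof
    show "h \<in> hom (free_nilpotent_group S c) H" using h by (simp add: free_nilpotent_group_def)
    show "h (free_nilpotent_gen S c a) = f a" if "a \<in> S" for a
    proof -
      have "[(a, True)] \<in> carrier (free_group S)"
        using that by (simp add: free_group_def reduced_def)
      moreover have "f a \<in> carrier H" using f that by auto
      ultimately show ?thesis
        using hv by (simp add: free_nilpotent_gen_def word_value_def letter_value_def)
    qed
  qed
qed

end

lemma free_nilpotent_universal_pair:
  assumes "a \<noteq> b" and H: "group H" and nilp: "lower_central H (Suc c) = {\<one>\<^bsub>H\<^esub>}"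
    and uv: "u \<in> carrier H" "v \<in> carrier H"
  shows "\<exists>h\<in>hom (free_nilpotent_group {a, b} c) H.
    h (free_nilpotent_gen {a, b} c a) = u \<and> h (free_nilpotent_gen {a, b} c b) = v"
proof -
  have f: "(\<lambda>d. if d = a then u else v) ` {a, b} \<subseteq> carrier H"
    using uv by auto
  show ?thesis
    by (rule free_nilpotent_universal[OF H nilp f], rule bexI, rule conjI)
      (use assms(1) in simp_all)
qed

section \<open>The shift group\<close>

text \<open>
  The quadruple \<open>(i, a, b, c)\<close> is the shift \<open>T \<mapsto> T + i\<close> together with the polynomial
  \<open>f = a T\<^sup>2 + b T + c\<close>, and \<open>(i, f) (i', f') = (i + i', f (T + i') + f')\<close>. Starting from
  \<open>T\<^sup>2\<close> instead of the binomial polynomial of degree two keeps all coordinates integral, at the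
  price of factors \<open>2\<close> that are harmless for odd \<open>p\<close>.
\<close>
definition shift_group :: "(int \<times> int \<times> int \<times> int) monoid" where
  "shift_group = \<lparr>carrier = UNIV,
     monoid.mult = (\<lambda>(i, a, b, c) (i', a', b', c').
       (i + i', a + a', b + 2 * i' * a + b', c + i' * b + i'\<^sup>2 * a + c')),
     one = (0, 0, 0, 0)\<rparr>"

lemma shift_group_carrier [simp]: "carrier shift_group = UNIV"
  and shift_group_one [simp]: "\<one>\<^bsub>shift_group\<^esub> = (0, 0, 0, 0)"
  and shift_group_mult [simp]: "(i, a, b, c) \<otimes>\<^bsub>shift_group\<^esub> (i', a', b', c') =
       (i + i', a + a', b + 2 * i' * a + b', c + i' * b + i'\<^sup>2 * a + c')"
  by (simp_all add: shift_group_def)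

lemma group_shift_group: "group shift_group"
proof (rule groupI)
  fix g h k :: "int \<times> int \<times> int \<times> int"
  show "g \<otimes>\<^bsub>shift_group\<^esub> h \<otimes>\<^bsub>shift_group\<^esub> k = g \<otimes>\<^bsub>shift_group\<^esub> (h \<otimes>\<^bsub>shift_group\<^esub> k)"
    by (cases g; cases h; cases k) (simp add: algebra_simps power2_eq_square)
next
  fix g :: "int \<times> int \<times> int \<times> int"
  obtain i a b c where g: "g = (i, a, b, c)" by (metis prod_cases4)
  have "(- i, - a, 2 * i * a - b, i * b - i\<^sup>2 * a - c) \<otimes>\<^bsub>shift_group\<^esub> g = \<one>\<^bsub>shift_group\<^esub>"
    by (simp add: g algebra_simps power2_eq_square)
  then show "\<exists>h\<in>carrier shift_group. h \<otimes>\<^bsub>shift_group\<^esub> g = \<one>\<^bsub>shift_group\<^esub>"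
    by auto
qed auto

interpretation U: group shift_group by (rule group_shift_group)

lemma shift_group_inv [simp]:
  "inv\<^bsub>shift_group\<^esub> (i, a, b, c) = (- i, - a, 2 * i * a - b, i * b - i\<^sup>2 * a - c)"
  by (rule U.inv_equality) (simp_all add: algebra_simps power2_eq_square)

lemma shift_group_commutator:
  "commutator shift_group (i, a, b, c) (i', a', b', c') =
     (0, 0, 2 * (i' * a - i * a'), i' * b + i'\<^sup>2 * a - i * b' - i\<^sup>2 * a')"
  by (subst U.commutator_eq_iff) (simp_all add: algebra_simps power2_eq_square)

text \<open>The terms of the lower central series consist of polynomials whose degree drops by one at
  every step, since the difference operator lowers degrees.\<close>
lemma shift_group_class: "lower_central shift_group 4 = {\<one>\<^bsub>shift_group\<^esub>}"
proof -
  have sub: "commutator_subgroup shift_group A (carrier shift_group) \<subseteq> B"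
    if "subgroup B shift_group" "\<And>a g. a \<in> A \<Longrightarrow> commutator shift_group a g \<in> B" for A B
    unfolding commutator_subgroup_def
    by (rule U.generate_subgroup_incl) (use that in auto)
  have 2: "lower_central shift_group (Suc (Suc 0)) \<subseteq> {(0, 0, b, c) | b c. True}"
    unfolding lower_central_Suc_Suc
    by (rule sub, unfold_locales) (auto simp: shift_group_commutator)
  have 3: "lower_central shift_group (Suc (Suc (Suc 0))) \<subseteq> {(0, 0, 0, c) | c. True}"
    unfolding lower_central_Suc_Suc[of _ "Suc 0"]
    by (rule sub, unfold_locales) (use 2 in \<open>auto simp: shift_group_commutator\<close>)
  have "lower_central shift_group (Suc (Suc (Suc (Suc 0)))) \<subseteq> {\<one>\<^bsub>shift_group\<^esub>}"
    unfolding lower_central_Suc_Suc[of _ "Suc (Suc 0)"]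
    by (rule sub, unfold_locales) (use 3 in \<open>auto simp: shift_group_commutator\<close>)
  then show ?thesis
    using U.lower_central_subgroup[THEN subgroup.one_closed, of 3]
    by (auto simp: numeral_eq_Suc)
qed

text \<open>The polynomial part of the \<open>n\<close>-th power is the sum of the polynomials \<open>f (T + t i)\<close>
  over \<open>t < n\<close>.\<close>
lemma shift_group_pow:
  "(i, a, b, c) [^]\<^bsub>shift_group\<^esub> (n :: nat) =
     (int n * i, int n * a, int n * b + 2 * i * a * (\<Sum>t<n. int t),
      int n * c + i * b * (\<Sum>t<n. int t) + i\<^sup>2 * a * (\<Sum>t<n. (int t)\<^sup>2))"
proof (induction n)
  case (Suc n)
  define P Q where "P = (\<Sum>t<n. int t)" and "Q = (\<Sum>t<n. (int t)\<^sup>2)"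
  have "(int n)\<^sup>2 = 2 * P + int n"
    unfolding P_def by (induction n) (simp_all add: algebra_simps power2_eq_square)
  then have eq: "(\<Sum>t<Suc n. (int t)\<^sup>2) = Q + 2 * P + int n"
    "(\<Sum>t<Suc n. int t) = P + int n"
    by (simp_all add: P_def Q_def)
  have "(i, a, b, c) [^]\<^bsub>shift_group\<^esub> Suc n =
      (int n * i, int n * a, int n * b + 2 * i * a * P, int n * c + i * b * P + i\<^sup>2 * a * Q)
        \<otimes>\<^bsub>shift_group\<^esub> (i, a, b, c)"
    using Suc.IH by (simp only: U.nat_pow_Suc P_def Q_def)
  then show ?case
    unfolding eq by (simp add: algebra_simps power2_eq_square)
qed simp

text \<open>The sums are \<open>p (p - 1) / 2\<close> and \<open>p (p - 1) (2 p - 1) / 6\<close>; for \<open>p = 3\<close> the second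
  one is \<open>5\<close>, and this is where \<open>p > 3\<close> enters.\<close>
lemma prime_dvd_sum_squares:
  fixes p :: nat
  assumes "Factorial_Ring.prime p" "p > 3"
  shows "int p dvd (\<Sum>t<p. int t)" "int p dvd (\<Sum>t<p. (int t)\<^sup>2)"
proof -
  have "coprime p 2" "coprime p 3"
    by (rule primes_coprime[OF assms(1)]; use assms(2) in simp)+
  then have "coprime (int p) (int 2)" "coprime (int p) (int 3)"
    by (simp_all only: coprime_int_iff)
  then have cop: "coprime (int p) 2" "coprime (int p) 3"
    by simp_all
  have s1: "2 * (\<Sum>t<n. int t) = int n * (int n - 1)" for n
    by (induction n) (auto simp: algebra_simps)
  have s2: "6 * (\<Sum>t<n. (int t)\<^sup>2) = int n * ((int n - 1) * (2 * int n - 1))" for n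
    by (induction n) (auto simp: algebra_simps power2_eq_square)
  have "int p dvd 2 * (\<Sum>t<p. int t)" by (simp add: s1)
  then show "int p dvd (\<Sum>t<p. int t)"
    using coprime_dvd_mult_right_iff[OF cop(1)] by blast
  have "int p dvd 2 * (3 * (\<Sum>t<p. (int t)\<^sup>2))" using s2[of p] by simp
  then show "int p dvd (\<Sum>t<p. (int t)\<^sup>2)"
    using coprime_dvd_mult_right_iff[OF cop(1)] coprime_dvd_mult_right_iff[OF cop(2)] by blast
qed

lemma shift_group_fst_snd:
  "fst (u \<otimes>\<^bsub>shift_group\<^esub> v) = fst u + fst v"
  "fst (snd (u \<otimes>\<^bsub>shift_group\<^esub> v)) = fst (snd u) + fst (snd v)"
  "fst (inv\<^bsub>shift_group\<^esub> u) = - fst u"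
  "fst (snd (inv\<^bsub>shift_group\<^esub> u)) = - fst (snd u)"
  by (cases u; cases v; simp)+

section \<open>Normal closures and orbits of automorphisms\<close>

lemma (in group) normal_closure_normal:
  assumes "S \<subseteq> carrier G"
  shows "normal_closure G S \<lhd> G"
proof (rule normal_invI)
  have "carrier G \<lhd> G" by (rule normal_self)
  then show "subgroup (normal_closure G S) G"
    unfolding normal_closure_def
    by (intro subgroups_Inter) (use assms in \<open>auto intro: normal_imp_subgroup\<close>)
  show "g \<otimes> h \<otimes> inv g \<in> normal_closure G S"
    if "g \<in> carrier G" "h \<in> normal_closure G S" for g h
    using that by (auto simp: normal_closure_def normal.inv_op_closed2)
qed

lemma normal_closure_incl: "S \<subseteq> normal_closure G S"
  by (auto simp: normal_closure_def)

lemma normal_closure_minimal: "\<lbrakk>H \<lhd> G; S \<subseteq> H\<rbrakk> \<Longrightarrow> normal_closure G S \<subseteq> H"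
  by (auto simp: normal_closure_def)

text \<open>The automorphism group consists of extensional functions and acts through restrictions to the
  set of subgroups; both disappear in this form.\<close>
lemma (in group) same_aut_orbit_iff:
  assumes A: "subgroup A G" and B: "subgroup B G"
  shows "(\<exists>Orb\<in>orbits (AutoGroup G) {H. subgroup H G} (aut_action G). A \<in> Orb \<and> B \<in> Orb)
    \<longleftrightarrow> (\<exists>\<phi>\<in>iso G G. \<phi> ` A = B)"
proof
  assume "\<exists>Orb\<in>orbits (AutoGroup G) {H. subgroup H G} (aut_action G). A \<in> Orb \<and> B \<in> Orb"
  then obtain H \<phi> \<psi> where H: "subgroup H G" and \<phi>: "\<phi> \<in> auto G" and \<psi>: "\<psi> \<in> auto G"
    and AB: "A = \<phi> ` H" "B = \<psi> ` H"
    by (auto simp: orbits_def orbit_def AutoGroup_def aut_action_def)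
  have iso: "\<phi> \<in> iso G G" "\<psi> \<in> iso G G"
    using \<phi> \<psi> by (auto simp: auto_def Bij_def iso_def)
  let ?\<chi> = "\<psi> \<circ> inv_into (carrier G) \<phi>"
  have "?\<chi> \<in> iso G G"
    using iso_set_trans[OF iso_set_sym[OF iso(1)] iso(2)] .
  moreover have "inv_into (carrier G) \<phi> ` \<phi> ` H = H"
    using iso(1) subgroup.subset[OF H]
    by (auto simp: iso_def bij_betw_def inv_into_image_cancel)
  then have "?\<chi> ` A = B" by (simp only: AB image_comp[symmetric])
  ultimately show "\<exists>\<phi>\<in>iso G G. \<phi> ` A = B" by blast
next
  assume "\<exists>\<phi>\<in>iso G G. \<phi> ` A = B"
  then obtain \<phi> where \<phi>: "\<phi> \<in> iso G G" "\<phi> ` A = B" by blast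
  let ?r = "\<lambda>h. restrict h (carrier G)"
  have r: "?r h \<in> auto G \<and> aut_action G (?r h) A = h ` A" if "h \<in> iso G G" for h
  proof
    show "?r h \<in> auto G"
      using that by (auto simp: auto_def Bij_def iso_def hom_def Pi_def bij_betw_def inj_on_def)
    have "?r h ` A = h ` A"
      by (rule image_cong) (use subgroup.subset[OF A] in auto)
    then show "aut_action G (?r h) A = h ` A"
      using A by (simp add: aut_action_def)
  qed
  let ?Orb = "orbit (AutoGroup G) (aut_action G) A"
  have "A \<in> ?Orb" "B \<in> ?Orb"
    using r[OF \<phi>(1)] r[OF id_iso] \<phi>(2)
    unfolding orbit_def AutoGroup_def by force+
  then show "\<exists>Orb\<in>orbits (AutoGroup G) {H. subgroup H G} (aut_action G). A \<in> Orb \<and> B \<in> Orb"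
    using A by (auto simp: orbits_def)
qed

section \<open>A normal form\<close>

lemma (in group) commute_pow:
  assumes "a \<in> carrier G" "b \<in> carrier G" "a \<otimes> b = b \<otimes> a"
  shows "a [^] (n :: nat) \<otimes> b = b \<otimes> a [^] n"
proof (induction n)
  case (Suc n)
  have "a [^] Suc n \<otimes> b = a [^] n \<otimes> (b \<otimes> a)" using assms by (simp add: m_assoc)
  also have "\<dots> = b \<otimes> a [^] Suc n" using assms Suc by (simp add: m_assoc[symmetric])
  finally show ?case .
qed (use assms in simp)

lemma (in group) pow_mult_swap:
  assumes "a \<in> carrier G" "b \<in> carrier G" "d \<in> carrier G"
    and "a \<otimes> b = b \<otimes> (a \<otimes> d)" and "a \<otimes> d = d \<otimes> a"
  shows "a [^] (n :: nat) \<otimes> b = b \<otimes> (a [^] n \<otimes> d [^] n)"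
proof -
  have "a [^] n \<otimes> b = b \<otimes> (a \<otimes> d) [^] n"
  proof (induction n)
    case (Suc n)
    have "a [^] Suc n \<otimes> b = a [^] n \<otimes> b \<otimes> (a \<otimes> d)"
      using assms(1-4) by (simp add: m_assoc)
    then show ?case using assms(1-3) Suc by (simp add: m_assoc)
  qed (use assms in simp)
  then show ?thesis by (simp only: pow_mult_distrib[OF assms(5,1,3)])
qed

lemma (in group) pow_mod:
  assumes "a \<in> carrier G" "a [^] m = \<one>"
  shows "a [^] (n :: nat) = a [^] (n mod m :: nat)"
proof -
  have "a [^] n = (a [^] m) [^] (n div m) \<otimes> a [^] (n mod m)"
    using assms(1) by (simp only: nat_pow_mult nat_pow_pow nat_pow_closed mult_div_mod_eq)
  then show ?thesis using assms by simp
qed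

text \<open>
  Collection: \<open>y x = x y c\<close> and \<open>c x = x c z\<close>, where \<open>z = [c, x]\<close> is central and is itself
  a power of \<open>x\<close>. So the set of words \<open>x\<^sup>i y\<^sup>j c\<^sup>k\<close> is closed under right
  multiplication by \<open>x\<close> and \<open>y\<close>, whose inverses are powers of them. The order of \<open>c\<close> divides
  \<open>p\<close> because \<open>x = y\<^sup>p x = x y\<^sup>p c\<^sup>p\<close>.
\<close>
lemma (in group) normal_form:
  fixes p r :: nat
  assumes xy: "x \<in> carrier G" "y \<in> carrier G"
    and gen: "generate G {x, y} = carrier G"
    and nilp: "lower_central G 4 = {\<one>}"
    and c: "c = commutator G y x"
    and "0 < p" and xp: "x [^] (p ^ 2) = \<one>" and yp: "y [^] p = \<one>"
    and cx: "commutator G c x = x [^] (r * p)" and cy: "commutator G c y = \<one>"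
    and g: "g \<in> carrier G"
  shows "\<exists>i<p ^ 2. \<exists>j<p. \<exists>k<p. g = x [^] i \<otimes> y [^] j \<otimes> c [^] k"
proof -
  define z where "z = x [^] (r * p)"
  have cc [simp]: "c \<in> carrier G" and zc [simp]: "z \<in> carrier G" using xy c by (auto simp: z_def)
  note xy [simp]
  have "z \<in> lower_central G (Suc (Suc (Suc 0)))"
    unfolding z_def cx[symmetric] c
    by (intro commutator_in_lower_central) (simp_all add: lower_central_1)
  then have "commutator G z u = \<one>" if "u \<in> carrier G" for u
    using commutator_in_lower_central[of z _ u] that nilp by (auto simp: numeral_eq_Suc)
  then have z_central: "z \<otimes> u = u \<otimes> z" if "u \<in> carrier G" for u
    using that commutator_eq_iff[of z u \<one>] by simp
  have zk: "z [^] k \<otimes> u = u \<otimes> z [^] k" if "u \<in> carrier G" for u and k :: nat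
    using commute_pow[OF zc that z_central[OF that]] .
  have yx: "y \<otimes> x = x \<otimes> (y \<otimes> c)"
    using mult_commutator[of y x] by (simp add: c m_assoc)
  have cx': "c \<otimes> x = x \<otimes> (c \<otimes> z)"
    using mult_commutator[of c x] by (simp add: cx z_def m_assoc)
  have cy': "c \<otimes> y = y \<otimes> c"
    using mult_commutator[of c y] by (simp add: cy)
  have yjx: "y [^] j \<otimes> x = x \<otimes> (y [^] j \<otimes> c [^] j)" for j :: nat
    by (rule pow_mult_swap) (simp_all add: yx cy')
  have ckx: "c [^] k \<otimes> x = x \<otimes> (c [^] k \<otimes> z [^] k)" for k :: nat
    by (rule pow_mult_swap) (simp_all add: cx' z_central)
  have cp: "c [^] p = \<one>"
    using yjx[of p] by (simp add: yp)
  define S where "S = {x [^] i \<otimes> y [^] j \<otimes> c [^] k | (i :: nat) (j :: nat) (k :: nat). True}"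
  have stepx: "s \<otimes> x \<in> S" if s_in: "s \<in> S" for s
  proof -
    obtain i j k where s: "s = x [^] (i :: nat) \<otimes> y [^] (j :: nat) \<otimes> c [^] (k :: nat)"
      using s_in unfolding S_def by blast
    have "s \<otimes> x = x [^] i \<otimes> (y [^] j \<otimes> (c [^] k \<otimes> x))" by (simp add: s m_assoc)
    also have "\<dots> = x [^] i \<otimes> ((y [^] j \<otimes> x) \<otimes> (c [^] k \<otimes> z [^] k))" by (simp add: ckx m_assoc)
    also have "\<dots> = x [^] i \<otimes> x \<otimes> (y [^] j \<otimes> (c [^] j \<otimes> c [^] k)) \<otimes> z [^] k"
      by (simp add: yjx m_assoc)
    also have "\<dots> = x [^] (i + 1) \<otimes> (z [^] k \<otimes> (y [^] j \<otimes> c [^] (j + k)))"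
      using zk[of "y [^] j \<otimes> c [^] (j + k)" k] by (simp add: nat_pow_mult m_assoc)
    also have "\<dots> = x [^] (i + 1) \<otimes> z [^] k \<otimes> y [^] j \<otimes> c [^] (j + k)"
      by (simp only: m_assoc m_closed nat_pow_closed xy cc zc)
    also have "x [^] (i + 1) \<otimes> z [^] k = x [^] (i + 1 + r * p * k)"
      by (simp only: z_def nat_pow_pow nat_pow_mult xy)
    finally show ?thesis unfolding S_def by blast
  qed
  have stepy: "s \<otimes> y \<in> S" if s_in: "s \<in> S" for s
  proof -
    obtain i j k where s: "s = x [^] (i :: nat) \<otimes> y [^] (j :: nat) \<otimes> c [^] (k :: nat)"
      using s_in unfolding S_def by blast
    have "s \<otimes> y = x [^] i \<otimes> (y [^] j \<otimes> (c [^] k \<otimes> y))" by (simp add: s m_assoc)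
    also have "\<dots> = x [^] i \<otimes> y [^] (j + 1) \<otimes> c [^] k"
      by (simp add: commute_pow[OF _ _ cy'] m_assoc)
    finally show ?thesis unfolding S_def by blast
  qed
  have S_carrier: "S \<subseteq> carrier G" by (auto simp: S_def)
  have pows: "s \<otimes> u [^] n \<in> S"
    if u: "u \<in> {x, y}" and s: "s \<in> S" for s u and n :: nat
  proof (induction n)
    case (Suc n)
    have "s \<otimes> u [^] Suc n = s \<otimes> u [^] n \<otimes> u" using S_carrier u s by (auto simp: m_assoc)
    then show ?case using stepx stepy Suc u by auto
  qed (use s S_carrier in auto)
  have invs: "inv x = x [^] (p ^ 2 - 1)" "inv y = y [^] (p - 1)"
    using xp yp \<open>0 < p\<close> nat_pow_Suc[of x "p ^ 2 - 1"] nat_pow_Suc[of y "p - 1"]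
    by (auto intro!: inv_equality)
  have closed: "\<forall>s\<in>S. s \<otimes> u \<in> S" if "u \<in> generate G {x, y}" for u
    using that
  proof (induction u rule: generate.induct)
    case one
    then show ?case using S_carrier by auto
  next
    case (incl h)
    then show ?case using stepx stepy by blast
  next
    case (inv h)
    then show ?case using pows invs by auto
  next
    case (eng u v)
    then have "u \<in> carrier G" "v \<in> carrier G" by (simp_all add: gen)
    moreover have "s \<otimes> u \<otimes> v \<in> S" if "s \<in> S" for s using eng.IH that by blast
    ultimately show ?case using S_carrier by (metis (no_types, lifting) m_assoc subsetD)
  qed
  have "\<one> = x [^] (0 :: nat) \<otimes> y [^] (0 :: nat) \<otimes> c [^] (0 :: nat)" by simp
  then have "\<one> \<in> S" unfolding S_def by blast
  then have "\<one> \<otimes> g \<in> S" using closed[of g] g gen by blast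
  then obtain i j k where "g = x [^] (i :: nat) \<otimes> y [^] (j :: nat) \<otimes> c [^] (k :: nat)"
    using g by (auto simp: S_def)
  also have "\<dots> = x [^] (i mod p ^ 2) \<otimes> y [^] (j mod p) \<otimes> c [^] (k mod p)"
    using pow_mod[of x "p ^ 2" i] pow_mod[of y p j] pow_mod[of c p k] xp yp cp by simp
  finally have "g = x [^] (i mod p ^ 2) \<otimes> y [^] (j mod p) \<otimes> c [^] (k mod p)" .
  moreover have "i mod p ^ 2 < p ^ 2" "j mod p < p" "k mod p < p" using \<open>0 < p\<close> by simp_all
  ultimately show ?thesis by blast
qed

section \<open>The relators in the shift group\<close>

text \<open>
  The last divisibility expresses the relation \<open>x\<^sup>r\<^sup>p = [y, x, x]\<close>: the left side is the shift by
  \<open>r p\<close>, and the right side the constant polynomial \<open>2\<close>.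
\<close>
definition relator_subgroup :: "int \<Rightarrow> int \<Rightarrow> (int \<times> int \<times> int \<times> int) set" where
  "relator_subgroup p r = {(i, a, b, c). p dvd a \<and> p dvd b \<and> p\<^sup>2 dvd 2 * i + r * p * c}"

lemma relator_subgroup_dvd_fst:
  assumes "odd p" "(i, a, b, c) \<in> relator_subgroup p r"
  shows "p dvd i"
proof -
  have "p dvd 2 * i + r * p * c"
    using assms(2) dvd_trans[of p "p\<^sup>2"] by (auto simp: relator_subgroup_def power2_eq_square)
  then have "p dvd 2 * i" by (simp add: dvd_add_left_iff)
  moreover have "coprime p 2" using assms(1) by simp
  ultimately show ?thesis using coprime_dvd_mult_right_iff by blast
qed

text \<open>Products, inverses and conjugates alter the last coordinate only by multiples of \<open>p\<close>, apart from
  what happens to it in an abelian group.\<close>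
lemma relator_subgroup_shift:
  assumes "p\<^sup>2 dvd 2 * i + r * p * c" "c' = c + p * q"
  shows "p\<^sup>2 dvd 2 * i + r * p * (c' :: int)"
proof -
  have "2 * i + r * p * c' = (2 * i + r * p * c) + p\<^sup>2 * (r * q)"
    by (simp add: assms(2) algebra_simps power2_eq_square)
  then show ?thesis using dvd_add[OF assms(1) dvd_triv_left] by metis
qed

lemma relator_subgroup_normal:
  assumes "odd p"
  shows "relator_subgroup p r \<lhd> shift_group"
proof (rule U.normal_invI)
  show "subgroup (relator_subgroup p r) shift_group"
  proof (rule U.subgroupI)
    show "relator_subgroup p r \<noteq> {}" by (auto simp: relator_subgroup_def intro!: exI[of _ 0])
  next
    fix g assume "g \<in> relator_subgroup p r"
    moreover obtain i a b c where g: "g = (i, a, b, c)" by (metis prod_cases4)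
    ultimately obtain a' b' where ab: "a = p * a'" "b = p * b'"
      and ic: "p\<^sup>2 dvd 2 * i + r * p * c"
      by (auto simp: relator_subgroup_def dvd_def[of p])
    from ic have "p\<^sup>2 dvd 2 * (- i) + r * p * (- c)"
      using dvd_minus_iff[of "p\<^sup>2" "2 * i + r * p * c"] by (simp del: dvd_minus_iff)
    then have "p\<^sup>2 dvd 2 * (- i) + r * p * (i * b - i\<^sup>2 * a - c)"
      by (rule relator_subgroup_shift[where q = "i * b' - i\<^sup>2 * a'"])
        (simp add: ab algebra_simps power2_eq_square)
    then show "inv\<^bsub>shift_group\<^esub> g \<in> relator_subgroup p r"
      by (simp add: g relator_subgroup_def ab)
  next
    fix g h assume "g \<in> relator_subgroup p r" "h \<in> relator_subgroup p r"
    moreover obtain i a b c where g: "g = (i, a, b, c)" by (metis prod_cases4)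
    moreover obtain i' a' b' c' where h: "h = (i', a', b', c')" by (metis prod_cases4)
    ultimately obtain a0 b0 where ab: "a = p * a0" "b = p * b0" "p dvd a'" "p dvd b'"
      and ic: "p\<^sup>2 dvd 2 * i + r * p * c" "p\<^sup>2 dvd 2 * i' + r * p * c'"
      by (auto simp: relator_subgroup_def dvd_def[of p])
    from dvd_add[OF ic] have "p\<^sup>2 dvd 2 * (i + i') + r * p * (c + c')"
      by (simp add: algebra_simps)
    then have "p\<^sup>2 dvd 2 * (i + i') + r * p * (c + i' * b + i'\<^sup>2 * a + c')"
      by (rule relator_subgroup_shift[where q = "i' * b0 + i'\<^sup>2 * a0"])
        (simp add: ab algebra_simps power2_eq_square)
    then show "g \<otimes>\<^bsub>shift_group\<^esub> h \<in> relator_subgroup p r"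
      using ab by (simp add: g h relator_subgroup_def)
  qed simp
next
  fix g h :: "int \<times> int \<times> int \<times> int"
  assume "h \<in> relator_subgroup p r"
  moreover obtain i a b c where h: "h = (i, a, b, c)" by (metis prod_cases4)
  moreover obtain u \<alpha> \<beta> \<gamma> where g: "g = (u, \<alpha>, \<beta>, \<gamma>)" by (metis prod_cases4)
  moreover have "p dvd i"
    using calculation relator_subgroup_dvd_fst[OF assms] by blast
  ultimately obtain i0 a0 b0 where iab: "i = p * i0" "a = p * a0" "b = p * b0"
    and ic: "p\<^sup>2 dvd 2 * i + r * p * c"
    by (auto simp: relator_subgroup_def dvd_def[of p])
  have "g \<otimes>\<^bsub>shift_group\<^esub> h \<otimes>\<^bsub>shift_group\<^esub> inv\<^bsub>shift_group\<^esub> g =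
      (i, a, b + 2 * i * \<alpha> - 2 * u * a, c + i * \<beta> + i\<^sup>2 * \<alpha> - 2 * u * i * \<alpha> - u * b + u\<^sup>2 * a)"
    by (simp add: g h algebra_simps power2_eq_square)
  moreover have "p\<^sup>2 dvd 2 * i + r * p *
      (c + i * \<beta> + i\<^sup>2 * \<alpha> - 2 * u * i * \<alpha> - u * b + u\<^sup>2 * a)"
    by (rule relator_subgroup_shift[OF ic,
          where q = "i0 * \<beta> + i0 * i * \<alpha> - 2 * u * i0 * \<alpha> - u * b0 + u\<^sup>2 * a0"])
      (simp add: iab algebra_simps power2_eq_square)
  ultimately show "g \<otimes>\<^bsub>shift_group\<^esub> h \<otimes>\<^bsub>shift_group\<^esub> inv\<^bsub>shift_group\<^esub> g \<in> relator_subgroup p r"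
    by (simp add: relator_subgroup_def iab)
qed

text \<open>All coordinates become divisible by \<open>p\<close>, and a second \<open>p\<close>-th power preserves this while it
  makes the shift divisible by \<open>p\<^sup>2\<close>.\<close>
lemma shift_group_prime_pow:
  fixes p :: nat
  assumes "Factorial_Ring.prime p" "p > 3"
  obtains b' c' where "(i, a, b, c) [^]\<^bsub>shift_group\<^esub> p =
      (int p * i, int p * a, int p * b', int p * c')"
proof -
  obtain P where P: "(\<Sum>t<p. int t) = int p * P"
    using prime_dvd_sum_squares(1)[OF assms] by blast
  obtain Q where Q: "(\<Sum>t<p. (int t)\<^sup>2) = int p * Q"
    using prime_dvd_sum_squares(2)[OF assms] by blast
  show thesis
    by (rule that[of "b + 2 * i * a * P" "c + i * b * P + i\<^sup>2 * a * Q"])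
      (simp add: shift_group_pow P Q algebra_simps)
qed

lemma shift_group_prime_square_pow:
  fixes p :: nat
  assumes "Factorial_Ring.prime p" "p > 3"
  shows "g [^]\<^bsub>shift_group\<^esub> (p ^ 2) \<in> relator_subgroup (int p) r"
proof -
  obtain i a b c where g: "g = (i, a, b, c)" by (metis prod_cases4)
  obtain b' c' where 1: "g [^]\<^bsub>shift_group\<^esub> p = (int p * i, int p * a, int p * b', int p * c')"
    unfolding g using shift_group_prime_pow[OF assms] by metis
  obtain b'' c'' where 2: "(int p * i, int p * a, int p * b', int p * c') [^]\<^bsub>shift_group\<^esub> p =
      (int p * (int p * i), int p * (int p * a), int p * b'', int p * c'')"
    using shift_group_prime_pow[OF assms] by metis
  have "g [^]\<^bsub>shift_group\<^esub> (p ^ 2) = (g [^]\<^bsub>shift_group\<^esub> p) [^]\<^bsub>shift_group\<^esub> p"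
    by (simp add: U.nat_pow_pow power2_eq_square)
  also have "\<dots> = (int p * (int p * i), int p * (int p * a), int p * b'', int p * c'')"
    by (simp only: 1 2)
  moreover have "2 * (int p * (int p * i)) + r * int p * (int p * c'') = (int p)\<^sup>2 * (2 * i + r * c'')"
    by (simp add: algebra_simps power2_eq_square)
  ultimately show ?thesis
    by (simp add: relator_subgroup_def)
qed

text \<open>Multiplication of the polynomial part by \<open>n\<close>, which \<open>e\<close> intertwines with the
  endomorphism of \<open>F\<close> that fixes \<open>x\<close> and replaces \<open>y\<close> by its \<open>n\<close>-th power.\<close>
definition shift_scale :: "int \<Rightarrow> int \<times> int \<times> int \<times> int \<Rightarrow> int \<times> int \<times> int \<times> int" where
  "shift_scale n = (\<lambda>(i, a, b, c). (i, n * a, n * b, n * c))"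

lemma shift_scale_hom: "shift_scale n \<in> hom shift_group shift_group"
  by (rule homI) (auto simp: shift_scale_def algebra_simps)

lemma shift_scale_relators_iff:
  assumes "p dvd s * n - r" "coprime n p"
  shows "shift_scale n g \<in> relator_subgroup p s \<longleftrightarrow> g \<in> relator_subgroup p r"
proof -
  obtain i a b c where g: "g = (i, a, b, c)" by (metis prod_cases4)
  obtain q where "s * n - r = p * q"
    using assms(1) by blast
  then have "s * n = r + p * q" by simp
  then have "2 * i + p * (s * n) * c = 2 * i + p * (r + p * q) * c" by simp
  then have "2 * i + s * p * (n * c) = (2 * i + r * p * c) + p\<^sup>2 * (q * c)"
    by (simp add: algebra_simps power2_eq_square)
  then have "p\<^sup>2 dvd 2 * i + s * p * (n * c) \<longleftrightarrow> p\<^sup>2 dvd 2 * i + r * p * c"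
    by (metis dvd_add_left_iff dvd_triv_left)
  moreover have "p dvd n * u \<longleftrightarrow> p dvd u" for u
    using assms(2) by (simp add: coprime_dvd_mult_right_iff coprime_commute)
  ultimately show ?thesis by (simp add: g shift_scale_def relator_subgroup_def)
qed

lemma nat_eq_if_dvd_diff:
  assumes "a < n" "b < n" "int n dvd int a - int b"
  shows "a = b"
proof -
  have "int a mod int n = int b mod int n" using assms(3) by (simp add: mod_eq_dvd_iff)
  then show ?thesis using assms(1,2) by simp
qed

section \<open>The quotients\<close>

text \<open>What is used of the free nilpotent group. The universal property appears only through its two
  relevant targets: the shift group, and \<open>F\<close> itself.\<close>
locale free_class_three = group F for F :: "('f, 'm) monoid_scheme" (structure) +
  fixes x y :: 'f and e :: "'f \<Rightarrow> int \<times> int \<times> int \<times> int"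
  assumes x_closed [simp]: "x \<in> carrier F" and y_closed [simp]: "y \<in> carrier F"
    and generated: "generate F {x, y} = carrier F"
    and class_three: "lower_central F 4 = {\<one>}"
    and e_hom: "e \<in> hom F shift_group"
    and e_x: "e x = (1, 0, 0, 0)" and e_y: "e y = (0, 1, 0, 0)"
    and endo: "\<lbrakk>u \<in> carrier F; v \<in> carrier F\<rbrakk> \<Longrightarrow> \<exists>\<theta>\<in>hom F F. \<theta> x = u \<and> \<theta> y = v"
begin

sublocale e: group_hom F shift_group e
  by unfold_locales (rule e_hom)

abbreviation c :: 'f where "c \<equiv> commutator F y x"

lemma e_c: "e c = (0, 0, 2, 1)"
  by (simp add: e.hom_commutator e_x e_y shift_group_commutator)

lemma e_cx: "e (commutator F c x) = (0, 0, 0, 2)"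
  by (simp add: e.hom_commutator e_x e_c shift_group_commutator)

lemma e_cy: "e (commutator F c y) = (0, 0, 0, 0)"
  by (simp add: e.hom_commutator e_y e_c shift_group_commutator)

lemma e_normal_word:
  "e (x [^] i \<otimes> y [^] j \<otimes> c [^] k) = (int i, int j, 2 * int k, int k)" for i j k :: nat
  by (simp add: e.hom_nat_pow e_x e_y e_c shift_group_pow)

lemma eq_on_generators:
  assumes "group_hom F H h" "group_hom F H k" "h x = k x" "h y = k y" "g \<in> carrier F"
  shows "h g = k g"
  by (rule hom_eq_on_generate[OF assms(1,2), of "{x, y}"]) (use assms generated in auto)

text \<open>The first two coordinates of \<open>e\<close> identify the abelianisation of \<open>F\<close> with
  \<open>\<int>\<^sup>2\<close>, and an endomorphism acts there by the matrix of the images of \<open>x\<close> and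
  \<open>y\<close>.\<close>
lemma endo_abelianised:
  assumes "h \<in> hom F F" "g \<in> carrier F"
  shows "fst (e (h g)) = fst (e g) * fst (e (h x)) + fst (snd (e g)) * fst (e (h y))"
    and "fst (snd (e (h g))) =
      fst (e g) * fst (snd (e (h x))) + fst (snd (e g)) * fst (snd (e (h y)))"
proof -
  interpret h: group_hom F F h by unfold_locales (rule assms(1))
  have "g \<in> generate F {x, y}" using assms(2) generated by simp
  then have "fst (e (h g)) = fst (e g) * fst (e (h x)) + fst (snd (e g)) * fst (e (h y)) \<and>
    fst (snd (e (h g))) =
      fst (e g) * fst (snd (e (h x))) + fst (snd (e g)) * fst (snd (e (h y)))"
  proof (induction g rule: generate.induct)
    case (inv g)
    then have "g \<in> carrier F" by auto
    then show ?case using inv by (auto simp: shift_group_fst_snd e_x e_y)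
  next
    case (eng u v)
    then have "u \<in> carrier F" "v \<in> carrier F" by (simp_all add: generated)
    then show ?case using eng.IH by (simp add: shift_group_fst_snd algebra_simps)
  qed (auto simp: e_x e_y)
  then show "fst (e (h g)) = fst (e g) * fst (e (h x)) + fst (snd (e g)) * fst (e (h y))"
    "fst (snd (e (h g))) =
      fst (e g) * fst (snd (e (h x))) + fst (snd (e g)) * fst (snd (e (h y)))"
    by simp_all
qed

text \<open>The matrices of an automorphism and of its inverse are integral and inverse to each other, so
  the product of their determinants is \<open>1\<close>.\<close>
lemma iso_det:
  assumes "\<phi> \<in> iso F F" "e (\<phi> x) = (a, b, B, C)" "e (\<phi> y) = (a', b', B', C')"
  shows "\<bar>a * b' - a' * b\<bar> = 1"
proof -
  let ?\<psi> = "inv_into (carrier F) \<phi>"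
  have hom: "\<phi> \<in> hom F F" "?\<psi> \<in> hom F F"
    using assms(1) iso_set_sym[OF assms(1)] by (auto simp: iso_def)
  have inv: "?\<psi> (\<phi> x) = x" "?\<psi> (\<phi> y) = y"
    using assms(1) by (auto simp: iso_def bij_betw_def)
  have closed: "\<phi> x \<in> carrier F" "\<phi> y \<in> carrier F" using hom(1) by (auto simp: hom_def)
  obtain \<alpha> \<beta> where 1: "fst (e (?\<psi> x)) = \<alpha>" "fst (snd (e (?\<psi> x))) = \<beta>" by blast
  obtain \<alpha>' \<beta>' where 2: "fst (e (?\<psi> y)) = \<alpha>'" "fst (snd (e (?\<psi> y))) = \<beta>'" by blast
  have eqs: "a * \<alpha> + b * \<alpha>' = 1" "a * \<beta> + b * \<beta>' = 0"
    "a' * \<alpha> + b' * \<alpha>' = 0" "a' * \<beta> + b' * \<beta>' = 1"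
    using endo_abelianised[OF hom(2) closed(1)] endo_abelianised[OF hom(2) closed(2)]
    by (simp_all add: inv 1 2 assms(2,3) e_x e_y)
  have "(a * b' - a' * b) * (\<alpha> * \<beta>' - \<alpha>' * \<beta>)
      = (a * \<alpha> + b * \<alpha>') * (a' * \<beta> + b' * \<beta>') - (a * \<beta> + b * \<beta>') * (a' * \<alpha> + b' * \<alpha>')"
    by (simp add: algebra_simps)
  also have "\<dots> = 1" by (simp add: eqs)
  finally show ?thesis using zmult_eq_1_iff by fastforce
qed

end

locale free_class_three_prime = free_class_three F x y e
  for F :: "('f, 'm) monoid_scheme" (structure) and x y e +
  fixes p :: nat
  assumes prime: "Factorial_Ring.prime p" and p3: "p > 3"
begin

abbreviation N :: "nat \<Rightarrow> 'f set" where "N \<equiv> N_sub F x y p"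

abbreviation third_relator :: "nat \<Rightarrow> 'f" where
  "third_relator r \<equiv> x [^] (- int (r * p)) \<otimes> commutator F c x"

lemma dvd_double_iff: "int p dvd 2 * u \<longleftrightarrow> int p dvd u" "(int p)\<^sup>2 dvd 2 * u \<longleftrightarrow> (int p)\<^sup>2 dvd u"
proof -
  have "odd p" using prime p3 prime_odd_nat by auto
  then have 1: "coprime (int p) 2" and 2: "coprime ((int p)\<^sup>2) 2" by simp_all
  show "int p dvd 2 * u \<longleftrightarrow> int p dvd u" using coprime_dvd_mult_right_iff[OF 1] .
  show "(int p)\<^sup>2 dvd 2 * u \<longleftrightarrow> (int p)\<^sup>2 dvd u" using coprime_dvd_mult_right_iff[OF 2] .
qed

lemma odd_p: "odd (int p)"
  using prime p3 prime_odd_nat by auto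

lemma p_square_dvd: "(int p)\<^sup>2 dvd int p * u \<longleftrightarrow> int p dvd u"
  using p3 by (simp add: power2_eq_square)

lemma prime_int: "Factorial_Ring.prime (int p)"
  using prime by simp

lemma N_normal: "N r \<lhd> F"
  unfolding N_sub_def by (rule normal_closure_normal) auto

lemma relators_in_N:
  "x [^] (p ^ 2) \<in> N r" "y [^] p \<in> N r" "third_relator r \<in> N r" "commutator F c y \<in> N r"
  unfolding N_sub_def using normal_closure_incl by fast+

lemma e_preimage_normal: "{g \<in> carrier F. e g \<in> relator_subgroup (int p) (int r)} \<lhd> F"
proof -
  interpret K: normal "relator_subgroup (int p) (int r)" shift_group
    by (rule relator_subgroup_normal[OF odd_p])
  show ?thesis
  proof (rule normal_invI)
    show "subgroup {g \<in> carrier F. e g \<in> relator_subgroup (int p) (int r)} F"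
      by (rule subgroupI) (use K.subgroup_axioms in \<open>auto intro: exI[of _ \<one>] simp: subgroup_def\<close>)
  qed (simp add: K.inv_op_closed2)
qed

lemma e_x_pow: "e (x [^] (- int n)) = (- int n, 0, 0, 0)"
  by (simp add: int_pow_neg_int e.hom_nat_pow e_x shift_group_pow)

lemma N_subset: "N r \<subseteq> {g \<in> carrier F. e g \<in> relator_subgroup (int p) (int r)}"
  unfolding N_sub_def
proof (rule normal_closure_minimal[OF e_preimage_normal])
  have "e (third_relator r) = (- int (r * p), 0, 0, 2)"
    by (simp add: e_cx e_x_pow del: of_nat_mult)
  then show "{x [^] (p ^ 2), y [^] p, third_relator r, commutator F c y}
      \<subseteq> {g \<in> carrier F. e g \<in> relator_subgroup (int p) (int r)}"
    by (simp add: e.hom_nat_pow e_x e_y shift_group_pow e_cy)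
      (simp add: relator_subgroup_def algebra_simps)
qed

definition q :: "nat \<Rightarrow> 'f \<Rightarrow> 'f set" where "q r g = N r #> g"

lemma quotient_hom: "group_hom F (F Mod N r) (q r)"
proof -
  interpret N: normal "N r" F by (rule N_normal)
  show ?thesis
    using N.r_coset_hom_Mod N.factorgroup_is_group
    by (simp add: group_hom_def group_hom_axioms_def is_group q_def[abs_def])
qed

text \<open>These rules would turn equations in the quotient group into equations between sets.\<close>
declare one_FactGroup [simp del] mult_FactGroup [simp del]

lemma quotient_surj: "q r ` carrier F = carrier (F Mod N r)"
  by (simp add: carrier_FactGroup q_def)

lemma q_one_iff: "g \<in> carrier F \<Longrightarrow> q r g = \<one>\<^bsub>F Mod N r\<^esub> \<longleftrightarrow> g \<in> N r"
  unfolding q_def one_FactGroup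
  using coset_join1[of "N r" g] coset_join2[of g "N r"] normal_imp_subgroup[OF N_normal] by blast

lemma q_eq_iff:
  assumes "g \<in> carrier F" "h \<in> carrier F"
  shows "q r g = q r h \<longleftrightarrow> g \<otimes> inv h \<in> N r"
proof -
  interpret q: group_hom F "F Mod N r" "q r" by (rule quotient_hom)
  have "q r (g \<otimes> inv h) = q r g \<otimes>\<^bsub>F Mod N r\<^esub> inv\<^bsub>F Mod N r\<^esub> q r h"
    using assms by simp
  then have "q r g = q r h \<longleftrightarrow> q r (g \<otimes> inv h) = \<one>\<^bsub>F Mod N r\<^esub>"
    using assms q.H.inv_solve_right[of "\<one>\<^bsub>F Mod N r\<^esub>" "q r g" "q r h"] by auto
  moreover have "g \<otimes> inv h \<in> carrier F" using assms by simp
  ultimately show ?thesis using q_one_iff by blast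
qed

lemma quotient_class: "lower_central (F Mod N r) 4 = {\<one>\<^bsub>F Mod N r\<^esub>}"
proof -
  interpret q: group_hom F "F Mod N r" "q r" by (rule quotient_hom)
  show ?thesis
    using q.lower_central_img[OF quotient_surj, of 3] class_three q.hom_one
    by (simp add: numeral_eq_Suc)
qed

text \<open>In the quotient the third relator reads \<open>[c, x] = x\<^sup>r\<^sup>p\<close>.\<close>
lemma quotient_normal_form:
  assumes "g \<in> carrier F"
  shows "\<exists>i<p ^ 2. \<exists>j<p. \<exists>k<p. q r g = q r (x [^] i \<otimes> y [^] j \<otimes> c [^] k)"
proof -
  interpret q: group_hom F "F Mod N r" "q r" by (rule quotient_hom)
  let ?Q = "F Mod N r"
  have "third_relator r \<in> carrier F" by simp
  then have "q r (third_relator r) = \<one>\<^bsub>?Q\<^esub>"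
    using relators_in_N(3) q_one_iff by blast
  then have "inv\<^bsub>?Q\<^esub> (q r (x [^] (r * p))) \<otimes>\<^bsub>?Q\<^esub> q r (commutator F c x) = \<one>\<^bsub>?Q\<^esub>"
    by (simp add: int_pow_neg_int del: of_nat_mult)
  then have cx: "q r (commutator F c x) = q r (x [^] (r * p))"
    using q.H.inv_solve_left'[of "\<one>\<^bsub>?Q\<^esub>" "q r (x [^] (r * p))" "q r (commutator F c x)"]
    by simp
  have "\<exists>i<p ^ 2. \<exists>j<p. \<exists>k<p. q r g = q r x [^]\<^bsub>?Q\<^esub> i \<otimes>\<^bsub>?Q\<^esub> q r y [^]\<^bsub>?Q\<^esub> j \<otimes>\<^bsub>?Q\<^esub> q r c [^]\<^bsub>?Q\<^esub> k"
  proof (rule q.H.normal_form[where r = r])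
    show "generate ?Q {q r x, q r y} = carrier ?Q"
      using q.generate_img[of "{x, y}"] generated quotient_surj by simp
    show "q r c = commutator ?Q (q r y) (q r x)"
      by (simp add: q.hom_commutator)
    show "q r x [^]\<^bsub>?Q\<^esub> p ^ 2 = \<one>\<^bsub>?Q\<^esub>" "q r y [^]\<^bsub>?Q\<^esub> p = \<one>\<^bsub>?Q\<^esub>"
      using q_one_iff relators_in_N by (simp_all add: q.hom_nat_pow[symmetric])
    show "commutator ?Q (q r c) (q r x) = q r x [^]\<^bsub>?Q\<^esub> (r * p)"
      using cx by (simp add: q.hom_commutator[symmetric] q.hom_nat_pow)
    show "commutator ?Q (q r c) (q r y) = \<one>\<^bsub>?Q\<^esub>"
      using q_one_iff relators_in_N
      by (simp add: q.hom_commutator[symmetric])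
  qed (use assms p3 quotient_class in auto)
  then show ?thesis
    by (simp add: q.hom_nat_pow[symmetric])
qed

text \<open>Comparison of the images under \<open>e\<close> determines the exponents one after the other: first
  \<open>j\<close>, then \<open>k\<close>, and then \<open>i\<close>, because the divisibility modulo \<open>p\<^sup>2\<close> involves
  \<open>k\<close> as well.\<close>
lemma normal_word_inj:
  fixes i j k i' j' k' :: nat
  assumes "i < p ^ 2" "j < p" "k < p" "i' < p ^ 2" "j' < p" "k' < p"
    and "x [^] i \<otimes> y [^] j \<otimes> c [^] k \<otimes> inv (x [^] i' \<otimes> y [^] j' \<otimes> c [^] k') \<in> N r"
  shows "i = i' \<and> j = j' \<and> k = k'"
proof -
  let ?w = "x [^] i \<otimes> y [^] j \<otimes> c [^] k" and ?w' = "x [^] i' \<otimes> y [^] j' \<otimes> c [^] k'"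
  have "e (?w \<otimes> inv ?w') \<in> relator_subgroup (int p) (int r)"
    using assms(7) N_subset by blast
  moreover have "e (?w \<otimes> inv ?w') = (int i, int j, 2 * int k, int k) \<otimes>\<^bsub>shift_group\<^esub>
      inv\<^bsub>shift_group\<^esub> (int i', int j', 2 * int k', int k')"
    using e_normal_word[of i j k] e_normal_word[of i' j' k'] by (simp del: shift_group_inv shift_group_mult)
  ultimately have *: "int p dvd int j - int j'"
    "int p dvd 2 * int k - 2 * int i' * int j + (2 * int i' * int j' - 2 * int k')"
    "(int p)\<^sup>2 dvd 2 * (int i - int i') + int r * int p *
      (int k - 2 * int i' * int k + (int i')\<^sup>2 * int j + (2 * int i' * int k' - (int i')\<^sup>2 * int j' - int k'))"
    by (simp_all add: relator_subgroup_def algebra_simps)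
  have j: "j = j'" using nat_eq_if_dvd_diff assms *(1) by blast
  have "int p dvd 2 * (int k - int k')" using *(2) by (simp add: j algebra_simps)
  then have k: "k = k'" using nat_eq_if_dvd_diff assms dvd_double_iff by blast
  have "(int p)\<^sup>2 dvd 2 * (int i - int i')" using *(3) by (simp add: j k)
  then have "int (p ^ 2) dvd int i - int i'" unfolding dvd_double_iff by simp
  then have "i = i'" using nat_eq_if_dvd_diff assms by blast
  with j k show ?thesis by simp
qed

text \<open>An element that satisfies the divisibilities is congruent modulo \<open>N r\<close> to a normal word
  that satisfies them too; this word is trivial by the bounds on its exponents.\<close>
lemma mem_N_iff:
  assumes g: "g \<in> carrier F"
  shows "g \<in> N r \<longleftrightarrow> e g \<in> relator_subgroup (int p) (int r)"
proof
  assume "g \<in> N r" then show "e g \<in> relator_subgroup (int p) (int r)" using N_subset by blast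
next
  assume eg: "e g \<in> relator_subgroup (int p) (int r)"
  let ?K = "{g \<in> carrier F. e g \<in> relator_subgroup (int p) (int r)}"
  have K: "subgroup ?K F" using normal_imp_subgroup[OF e_preimage_normal] .
  obtain i j k where ijk: "i < p ^ 2" "j < p" "k < p"
    and qg: "q r g = q r (x [^] i \<otimes> y [^] j \<otimes> c [^] k)"
    using quotient_normal_form[OF g] by blast
  let ?w = "x [^] i \<otimes> y [^] j \<otimes> c [^] k"
  have w: "?w \<in> carrier F" by simp
  have "g \<otimes> inv ?w \<in> ?K"
    using qg q_eq_iff[OF g w] N_subset by blast
  moreover have "g \<in> ?K" using g eg by simp
  ultimately have "inv (g \<otimes> inv ?w) \<otimes> g \<in> ?K"
    using subgroup.m_closed[OF K] subgroup.m_inv_closed[OF K] by blast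
  moreover have "inv (g \<otimes> inv ?w) \<otimes> g = ?w"
    using g w by (simp add: inv_mult_group m_assoc)
  ultimately have "(int i, int j, 2 * int k, int k) \<in> relator_subgroup (int p) (int r)"
    using e_normal_word[of i j k] by simp
  then have *: "int p dvd int j - int 0" "int p dvd 2 * int k"
    "(int p)\<^sup>2 dvd 2 * int i + int r * int p * int k"
    by (simp_all add: relator_subgroup_def)
  have j: "j = 0" using nat_eq_if_dvd_diff[OF ijk(2) _ *(1)] p3 by simp
  have "int p dvd int k - int 0" using *(2) dvd_double_iff by simp
  then have k: "k = 0" using nat_eq_if_dvd_diff[OF ijk(3)] p3 by blast
  have "int (p ^ 2) dvd int i - int 0" using *(3) dvd_double_iff by (simp add: k)
  then have "i = 0" using nat_eq_if_dvd_diff[OF ijk(1), of 0] p3 by simp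
  with j k qg have "q r g = q r \<one>" by simp
  then show "g \<in> N r" using q_eq_iff[OF g one_closed] g by simp
qed

lemma quotient_order: "card (carrier (F Mod N r)) = p ^ 4"
proof -
  let ?w = "\<lambda>(i :: nat, j :: nat, k :: nat). x [^] i \<otimes> y [^] j \<otimes> c [^] k"
  let ?I = "{..<p ^ 2} \<times> {..<p} \<times> {..<p}"
  have w: "?w t \<in> carrier F" for t by (cases t) simp
  have "carrier (F Mod N r) \<subseteq> (\<lambda>t. q r (?w t)) ` ?I"
  proof
    fix v assume "v \<in> carrier (F Mod N r)"
    then obtain g where g: "g \<in> carrier F" "v = q r g"
      using quotient_surj by blast
    then obtain i j k where "i < p ^ 2" "j < p" "k < p"
      and "v = q r (x [^] i \<otimes> y [^] j \<otimes> c [^] k)"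
      using quotient_normal_form[of g r] by blast
    then show "v \<in> (\<lambda>t. q r (?w t)) ` ?I" by (intro image_eqI[of _ _ "(i, j, k)"]) auto
  qed
  moreover have "(\<lambda>t. q r (?w t)) ` ?I \<subseteq> carrier (F Mod N r)"
    using w quotient_surj by blast
  moreover have "inj_on (\<lambda>t. q r (?w t)) ?I"
  proof (rule inj_onI)
    fix t u assume t: "t \<in> ?I" and u: "u \<in> ?I" and "q r (?w t) = q r (?w u)"
    then have "?w t \<otimes> inv (?w u) \<in> N r" using q_eq_iff w by blast
    then show "t = u" using normal_word_inj t u by (cases t; cases u) auto
  qed
  ultimately have "card (carrier (F Mod N r)) = card ?I"
    by (metis (no_types, lifting) card_image subset_antisym)
  also have "\<dots> = p ^ 4" by (simp add: card_cartesian_product power_def numeral_eq_Suc)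
  finally show ?thesis .
qed

lemma p_square_pow_in_N: "g \<in> carrier F \<Longrightarrow> g [^] (p ^ 2) \<in> N r"
  using shift_group_prime_square_pow[OF prime p3] by (simp add: mem_N_iff e.hom_nat_pow)

lemma quotient_exponent: "has_exponent (F Mod N r) (p ^ 2)"
  unfolding has_exponent_def
proof (intro conjI ballI allI impI)
  interpret q: group_hom F "F Mod N r" "q r" by (rule quotient_hom)
  show "0 < p ^ 2" using p3 by simp
  show "u [^]\<^bsub>F Mod N r\<^esub> p ^ 2 = \<one>\<^bsub>F Mod N r\<^esub>" if u: "u \<in> carrier (F Mod N r)" for u
  proof -
    obtain g where "g \<in> carrier F" "u = q r g" using u quotient_surj by blast
    then show ?thesis
      using q_one_iff p_square_pow_in_N by (simp add: q.hom_nat_pow[symmetric])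
  qed
  show "\<exists>u\<in>carrier (F Mod N r). u [^]\<^bsub>F Mod N r\<^esub> m \<noteq> \<one>\<^bsub>F Mod N r\<^esub>" if m: "0 < m \<and> m < p ^ 2" for m
  proof -
    have "\<not> (int p)\<^sup>2 dvd int m"
      using m by (metis dvd_imp_le not_less of_nat_dvd_iff of_nat_power)
    then have "x [^] m \<notin> N r"
      using dvd_double_iff by (simp add: mem_N_iff e.hom_nat_pow e_x shift_group_pow relator_subgroup_def)
    then have "q r x [^]\<^bsub>F Mod N r\<^esub> m \<noteq> \<one>\<^bsub>F Mod N r\<^esub>"
      using q_one_iff by (simp add: q.hom_nat_pow[symmetric])
    then show ?thesis using q.hom_closed x_closed by blast
  qed
qed

lemma quotient_p_group: "p_group p (F Mod N r)"
  unfolding p_group_def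
proof (intro conjI ballI)
  interpret q: group_hom F "F Mod N r" "q r" by (rule quotient_hom)
  show "group (F Mod N r)" by (rule q.H.is_group)
  fix u assume u: "u \<in> carrier (F Mod N r)"
  then have "u [^]\<^bsub>F Mod N r\<^esub> p ^ 2 = \<one>\<^bsub>F Mod N r\<^esub>"
    using quotient_exponent by (simp add: has_exponent_def)
  then have "group.ord (F Mod N r) u dvd p ^ 2"
    using u q.H.pow_eq_id by blast
  then show "\<exists>k. group.ord (F Mod N r) u = p ^ k"
    using divides_primepow_nat[OF prime] by blast
qed

lemma not_dvd_index:
  assumes "r \<in> {1..p - 1}"
  shows "\<not> int p dvd int r"
  using assms p3 by (auto dest!: dvd_imp_le)

text \<open>The elements \<open>y\<close>, \<open>[y, x]\<close> and \<open>[y, x, x]\<close> witness that the first three terms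
  of the lower central series are nontrivial.\<close>
lemma quotient_has_class_3:
  assumes r: "r \<in> {1..p - 1}"
  shows "has_nilpotency_class (F Mod N r) 3"
  unfolding has_nilpotency_class_def
proof (intro conjI allI impI)
  interpret q: group_hom F "F Mod N r" "q r" by (rule quotient_hom)
  show "lower_central (F Mod N r) (3 + 1) = {\<one>\<^bsub>F Mod N r\<^esub>}"
    using quotient_class by simp
  have nontrivial: "lower_central (F Mod N r) (Suc d) \<noteq> {\<one>\<^bsub>F Mod N r\<^esub>}"
    if g: "g \<in> lower_central F (Suc d)" "g \<notin> N r" for d g
  proof -
    have "g \<in> carrier F" using g(1) lower_central_subgroup subgroup.subset by blast
    then have "q r g \<noteq> \<one>\<^bsub>F Mod N r\<^esub>" using g(2) q_one_iff by blast
    moreover have "q r g \<in> lower_central (F Mod N r) (Suc d)"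
      using g(1) q.lower_central_img_subset by blast
    ultimately show ?thesis by blast
  qed
  have y1: "y \<in> lower_central F (Suc 0)" by (simp add: lower_central_1)
  then have c2: "c \<in> lower_central F (Suc (Suc 0))" by (simp add: commutator_in_lower_central)
  then have c3: "commutator F c x \<in> lower_central F (Suc (Suc (Suc 0)))"
    by (simp add: commutator_in_lower_central)
  have p1: "\<not> int p dvd 1" "\<not> int p dvd 2"
    using p3 dvd_double_iff(1)[of 1] by auto
  have "y \<notin> N r" "c \<notin> N r"
    using p1 by (simp_all add: mem_N_iff e_y e_c relator_subgroup_def)
  moreover have "commutator F c x \<notin> N r"
  proof
    assume "commutator F c x \<in> N r"
    then have "(int p)\<^sup>2 dvd 2 * (int p * int r)"
      by (simp add: mem_N_iff e_cx relator_subgroup_def ac_simps)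
    then have "int p dvd int r" by (simp only: dvd_double_iff p_square_dvd)
    then show False using not_dvd_index[OF r] by blast
  qed
  moreover fix d :: nat assume "d < 3"
  then have "d = 0 \<or> d = Suc 0 \<or> d = Suc (Suc 0)" by linarith
  ultimately show "lower_central (F Mod N r) (d + 1) \<noteq> {\<one>\<^bsub>F Mod N r\<^esub>}"
    using nontrivial[OF y1] nontrivial[OF c2] nontrivial[OF c3] by auto
qed

section \<open>Scaling the second generator\<close>

text \<open>The map \<open>\<theta>\<close> is in general not surjective, but it relates \<open>N r\<close> and
  \<open>N s\<close> exactly, since membership is decided by \<open>e\<close>.\<close>
lemma endo_scale:
  assumes v: "v \<in> carrier F" "e v = (0, n, 0, 0)" and n: "int p dvd int s * n - int r"
    and "\<not> int p dvd n"
  obtains \<theta> where "\<theta> \<in> hom F F" "\<theta> x = x" "\<theta> y = v"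
    and "\<And>g. g \<in> carrier F \<Longrightarrow> \<theta> g \<in> N s \<longleftrightarrow> g \<in> N r"
proof -
  obtain \<theta> where \<theta>: "\<theta> \<in> hom F F" "\<theta> x = x" "\<theta> y = v"
    using endo[OF x_closed v(1)] by blast
  interpret t: group_hom F F \<theta> by unfold_locales (rule \<theta>(1))
  have "coprime n (int p)"
    using prime_int assms(4) prime_imp_coprime coprime_commute by blast
  note scale = shift_scale_relators_iff[OF n this]
  have "e (\<theta> g) = shift_scale n (e g)" if g: "g \<in> carrier F" for g
  proof -
    have "group_hom F shift_group (e \<circ> \<theta>)" "group_hom F shift_group (shift_scale n \<circ> e)"
      using Group.hom_compose[OF \<theta>(1) e_hom] Group.hom_compose[OF e_hom shift_scale_hom]
      by (simp_all add: group_hom_def group_hom_axioms_def group_shift_group)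
    then show ?thesis
      using eq_on_generators[of shift_group "e \<circ> \<theta>" "shift_scale n \<circ> e" g] g
      by (simp add: \<theta> v e_x e_y shift_scale_def)
  qed
  then have "\<theta> g \<in> N s \<longleftrightarrow> g \<in> N r" if "g \<in> carrier F" for g
    using that by (simp add: mem_N_iff scale)
  with \<theta> show thesis using that by blast
qed

lemma quotients_isomorphic:
  assumes r: "r \<in> {1..p - 1}" and s: "s \<in> {1..p - 1}"
  shows "F Mod N r \<cong> F Mod N s"
proof -
  obtain u v where uv: "u * int s + v * int p = gcd (int s) (int p)"
    using bezout_int by blast
  have "gcd (int s) (int p) = 1"
    using not_dvd_index[OF s] prime_imp_coprime[OF prime_int] by (metis coprime_iff_gcd_eq_1 gcd.commute)
  then have *: "u * int s = 1 - v * int p" using uv by simp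
  \<comment> \<open>\<open>u\<close> is an inverse of \<open>s\<close> modulo \<open>p\<close>, so \<open>s n\<close> is congruent to \<open>r\<close>.\<close>
  define n where "n = u * int r"
  have "int s * n - int r = (u * int s) * int r - int r" by (simp add: n_def algebra_simps)
  also have "\<dots> = int p * (- v * int r)" unfolding * by (simp add: algebra_simps)
  finally have n: "int p dvd int s * n - int r" by simp
  have "\<not> int p dvd n"
  proof
    assume "int p dvd n"
    then have "int p dvd int s * n - (int s * n - int r)" using n by (simp only: dvd_diff dvd_mult)
    then show False using not_dvd_index[OF r] by simp
  qed
  moreover have "e (y [^] n) = (0, n, 0, 0)"
    by (cases n rule: int_cases2)
      (simp_all add: int_pow_int int_pow_neg_int e.hom_nat_pow e_y shift_group_pow)
  ultimately obtain \<theta> where \<theta>: "\<theta> \<in> hom F F"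
    and \<theta>_N: "\<And>g. g \<in> carrier F \<Longrightarrow> \<theta> g \<in> N s \<longleftrightarrow> g \<in> N r"
    using endo_scale[of "y [^] n" n s r] n by auto
  interpret q: group_hom F "F Mod N s" "q s" by (rule quotient_hom)
  interpret t: group_hom F "F Mod N s" "q s \<circ> \<theta>"
    by unfold_locales (rule Group.hom_compose[OF \<theta> q.homh])
  have sub: "N r \<subseteq> carrier F"
    using subgroup.subset[OF normal_imp_subgroup[OF N_normal]] .
  have "(q s \<circ> \<theta>) g = \<one>\<^bsub>F Mod N s\<^esub> \<longleftrightarrow> g \<in> N r" if "g \<in> carrier F" for g
    using that \<theta>_N q_one_iff hom_in_carrier[OF \<theta>] by simp
  then have "kernel F (F Mod N s) (q s \<circ> \<theta>) = N r"
    using sub unfolding kernel_def by blast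
  then have hom: "(\<lambda>A. the_elem ((q s \<circ> \<theta>) ` A)) \<in> hom (F Mod N r) (F Mod N s)"
    and inj: "inj_on (\<lambda>A. the_elem ((q s \<circ> \<theta>) ` A)) (carrier (F Mod N r))"
    using t.FactGroup_hom t.FactGroup_inj_on by simp_all
  have "finite (carrier (F Mod N s))"
    using quotient_order[of s] p3 by (intro card_ge_0_finite) simp
  moreover have "(\<lambda>A. the_elem ((q s \<circ> \<theta>) ` A)) ` carrier (F Mod N r) \<subseteq> carrier (F Mod N s)"
    using hom by (auto simp: hom_def)
  moreover have "card ((\<lambda>A. the_elem ((q s \<circ> \<theta>) ` A)) ` carrier (F Mod N r))
      = card (carrier (F Mod N s))"
    using card_image[OF inj] by (simp add: quotient_order)
  ultimately have "(\<lambda>A. the_elem ((q s \<circ> \<theta>) ` A)) ` carrier (F Mod N r) = carrier (F Mod N s)"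
    by (rule card_subset_eq)
  then show ?thesis
    using hom inj by (auto simp: is_iso_def iso_def bij_betw_def)
qed

section \<open>Orbits\<close>

text \<open>For \<open>n = - 1\<close> the scaling endomorphism is an involution, hence an automorphism.\<close>
lemma opposite_same_orbit:
  assumes r: "r \<in> {1..p - 1}"
  shows "\<exists>\<phi>\<in>iso F F. \<phi> ` N r = N (p - r)"
proof -
  have "int (p - r) * (- 1) - int r = - int p" using r p3 by (auto simp: of_nat_diff)
  then have "int p dvd int (p - r) * (- 1) - int r" by (metis dvd_minus_iff dvd_refl)
  moreover have "e (inv y) = (0, - 1, 0, 0)" by (simp add: e_y)
  moreover have "\<not> int p dvd - 1" using p3 by simp
  ultimately obtain \<theta> where \<theta>: "\<theta> \<in> hom F F" "\<theta> x = x" "\<theta> y = inv y"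
    and \<theta>_N: "\<And>g. g \<in> carrier F \<Longrightarrow> \<theta> g \<in> N (p - r) \<longleftrightarrow> g \<in> N r"
    using endo_scale[of "inv y" "- 1" "p - r" r] by auto
  interpret t: group_hom F F \<theta> by unfold_locales (rule \<theta>(1))
  have inv: "\<theta> (\<theta> g) = g" if "g \<in> carrier F" for g
  proof -
    have "group_hom F F (\<theta> \<circ> \<theta>)" "group_hom F F id"
      using Group.hom_compose[OF \<theta>(1) \<theta>(1)] id_iso[of F]
      by (simp_all add: group_hom_def group_hom_axioms_def iso_def is_group)
    then show ?thesis
      using eq_on_generators[of F "\<theta> \<circ> \<theta>" id g] that by (simp add: \<theta>)
  qed
  have "bij_betw \<theta> (carrier F) (carrier F)"
    by (rule bij_betw_byWitness[where f' = \<theta>]) (auto simp: inv)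
  then have iso: "\<theta> \<in> iso F F" using \<theta>(1) by (simp add: iso_def)
  have sub: "N s \<subseteq> carrier F" for s
    using subgroup.subset[OF normal_imp_subgroup[OF N_normal]] .
  have "\<theta> ` N r = N (p - r)"
  proof
    show "\<theta> ` N r \<subseteq> N (p - r)" using \<theta>_N sub by blast
    show "N (p - r) \<subseteq> \<theta> ` N r"
    proof
      fix g assume g: "g \<in> N (p - r)"
      then have gc: "g \<in> carrier F" using sub by blast
      then have "\<theta> g \<in> N r" using g \<theta>_N[of "\<theta> g"] by (simp add: inv)
      then show "g \<in> \<theta> ` N r" using inv[OF gc] by force
    qed
  qed
  with iso show ?thesis by blast
qed

text \<open>Each relator of \<open>N r\<close> yields a congruence when its image is tested against \<open>N s\<close>;
  those of \<open>y\<^sup>p\<close> and of the third relator suffice.\<close>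
lemma same_orbit_imp:
  assumes r: "r \<in> {1..p - 1}" and s: "s \<in> {1..p - 1}"
    and \<phi>: "\<phi> \<in> iso F F" "\<phi> ` N r = N s"
  shows "r = s \<or> r = p - s"
proof -
  interpret h: group_hom F F \<phi>
    by unfold_locales (use \<phi> in \<open>simp add: iso_def\<close>)
  obtain a b B C where X: "e (\<phi> x) = (a, b, B, C)" by (metis prod_cases4)
  obtain a' b' B' C' where Y: "e (\<phi> y) = (a', b', B', C')" by (metis prod_cases4)
  define \<delta> where "\<delta> = a * b' - a' * b"
  have \<delta>: "\<bar>\<delta>\<bar> = 1" unfolding \<delta>_def by (rule iso_det[OF \<phi>(1) X Y])
  have image: "e (\<phi> g) \<in> relator_subgroup (int p) (int s)" if "g \<in> N r" for g
    using that \<phi>(2) N_subset by blast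
  have p_a': "int p dvd a'"
  proof -
    obtain u w where pow: "(a', b', B', C') [^]\<^bsub>shift_group\<^esub> p = (int p * a', int p * b', int p * u, int p * w)"
      using shift_group_prime_pow[OF prime p3] by metis
    have "e (\<phi> (y [^] p)) = (int p * a', int p * b', int p * u, int p * w)"
      by (simp add: h.hom_nat_pow e.hom_nat_pow Y pow)
    then have "(int p)\<^sup>2 dvd 2 * (int p * a') + int s * int p * (int p * w)"
      using image[OF relators_in_N(2)] by (simp add: relator_subgroup_def)
    moreover have "2 * (int p * a') + int s * int p * (int p * w) = int p * (2 * a' + int p * (int s * w))"
      by (simp add: algebra_simps)
    ultimately have "int p dvd 2 * a' + int p * (int s * w)" by (simp only: p_square_dvd)
    then have "int p dvd 2 * a'" by (simp add: dvd_add_left_iff)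
    then show ?thesis using dvd_double_iff by blast
  qed
  \<comment> \<open>Otherwise \<open>p\<close> would divide the first column of the matrix, hence its determinant.\<close>
  have p_a: "\<not> int p dvd a"
  proof
    assume "int p dvd a"
    then have "int p dvd \<delta>" using p_a' by (simp add: \<delta>_def)
    then have "int p dvd \<bar>\<delta>\<bar>" by simp
    then show False using \<delta> p3 by simp
  qed
  \<comment> \<open>Modulo terms absorbed by \<open>p\<^sup>2\<close>, the third relator goes to the shift by \<open>- r p a\<close>
     times the constant polynomial \<open>2 \<delta> a\<close>.\<close>
  have "int p dvd a * (int s * \<delta> - int r)"
  proof -
    obtain u w where pow: "(a, b, B, C) [^]\<^bsub>shift_group\<^esub> p = (int p * a, int p * b, int p * u, int p * w)"
      using shift_group_prime_pow[OF prime p3] by metis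
    define w' where "w' = int r * w + int p * a * u * (\<Sum>t<r. int t)
      + int p * int p * a\<^sup>2 * b * (\<Sum>t<r. (int t)\<^sup>2)"
    have "e (\<phi> (x [^] (r * p))) = ((a, b, B, C) [^]\<^bsub>shift_group\<^esub> p) [^]\<^bsub>shift_group\<^esub> r"
      by (simp add: h.hom_nat_pow e.hom_nat_pow X U.nat_pow_pow mult.commute)
    also have "\<dots> = (int p * a, int p * b, int p * u, int p * w) [^]\<^bsub>shift_group\<^esub> r"
      by (simp only: pow)
    also obtain U where "\<dots> = (int r * (int p * a), int r * (int p * b), U, int p * w')"
      by (simp add: shift_group_pow w'_def algebra_simps power2_eq_square)
    finally have 1: "e (\<phi> (x [^] (r * p))) = (int r * (int p * a), int r * (int p * b), U, int p * w')" .
    have 2: "e (\<phi> (commutator F c x)) = (0, 0, 0, 2 * \<delta> * a)"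
      by (simp add: h.hom_commutator e.hom_commutator X Y shift_group_commutator \<delta>_def algebra_simps)
    define m where "m = int r * a * U - (int r * (int p * a))\<^sup>2 * (int r * b) - w'"
    have "inv\<^bsub>shift_group\<^esub> e (\<phi> (x [^] (r * p))) = (- (int r * (int p * a)), - (int r * (int p * b)),
        2 * (int r * (int p * a)) * (int r * (int p * b)) - U, int p * m)"
      unfolding 1 by (simp add: m_def algebra_simps power2_eq_square)
    then obtain V V' where inv1: "inv\<^bsub>shift_group\<^esub> e (\<phi> (x [^] (r * p))) =
        (- (int r * (int p * a)), V, V', int p * m)"
      by blast
    have "e (\<phi> (third_relator r)) = inv\<^bsub>shift_group\<^esub> e (\<phi> (x [^] (r * p))) \<otimes>\<^bsub>shift_group\<^esub> (0, 0, 0, 2 * \<delta> * a)"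
      by (simp add: 2 int_pow_neg_int del: of_nat_mult shift_group_inv shift_group_mult)
    also have "\<dots> = (- (int r * (int p * a)), V, V', int p * m + 2 * \<delta> * a)"
      by (simp only: inv1) simp
    finally have "(int p)\<^sup>2 dvd 2 * (- (int r * (int p * a))) + int s * int p * (int p * m + 2 * \<delta> * a)"
      using image[OF relators_in_N(3)] by (simp only: relator_subgroup_def) simp
    moreover have "2 * (- (int r * (int p * a))) + int s * int p * (int p * m + 2 * \<delta> * a)
        = int p * (2 * (a * (int s * \<delta> - int r)) + int p * (int s * m))"
      by (simp add: algebra_simps)
    ultimately have "int p dvd 2 * (a * (int s * \<delta> - int r)) + int p * (int s * m)"
      by (simp only: p_square_dvd)
    then have "int p dvd 2 * (a * (int s * \<delta> - int r))"
      using dvd_add_left_iff[OF dvd_triv_left] by blast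
    then show ?thesis using dvd_double_iff by blast
  qed
  then have p_diff: "int p dvd int s * \<delta> - int r"
    using p_a prime_int prime_dvd_mult_iff by blast
  have "\<delta> = 1 \<or> \<delta> = - 1" using \<delta> by linarith
  then show ?thesis
  proof
    assume "\<delta> = 1"
    then have "int p dvd int s - int r" using p_diff by simp
    moreover have "s < p" "r < p" using r s p3 by auto
    ultimately show ?thesis using nat_eq_if_dvd_diff by blast
  next
    assume "\<delta> = - 1"
    then have "int p dvd - (int s + int r)" using p_diff by simp
    then have dvd: "int p dvd int p + - (int s + int r)" by (rule dvd_add[OF dvd_refl])
    have "s \<le> p" using s by auto
    then have "int p + - (int s + int r) = int (p - s) - int r" by (simp add: of_nat_diff)
    with dvd have "int p dvd int (p - s) - int r" by (simp only:)
    moreover have "p - s < p" "r < p" using r s p3 by auto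
    ultimately show ?thesis using nat_eq_if_dvd_diff[of "p - s" p r] by simp
  qed
qed

end

theorem mainTheorem1:
  fixes a b :: 'a and p :: nat
  assumes "a \<noteq> b" and "Factorial_Ring.prime p" and "p > 3"
  shows
    "let F = free_nilpotent_group {a, b} 3;
         x = free_nilpotent_gen {a, b} 3 a;
         y = free_nilpotent_gen {a, b} 3 b;
         N = N_sub F x y p
     in
       (\<forall>r\<in>{1..p-1}.
          p_group p (F Mod N r) \<and> order (F Mod N r) = p ^ 4 \<and>
          has_nilpotency_class (F Mod N r) 3 \<and> has_exponent (F Mod N r) (p ^ 2)) \<and>
       (\<forall>r\<in>{1..p-1}. \<forall>s\<in>{1..p-1}. F Mod N r \<cong> F Mod N s) \<and>
       (\<forall>r\<in>{1..p-1}. \<forall>s\<in>{1..p-1}.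
          (\<exists>Orb\<in>orbits (AutoGroup F) {H. subgroup H F} (aut_action F). N r \<in> Orb \<and> N s \<in> Orb)
            \<longleftrightarrow> r = s \<or> r = p - s)"
proof -
  define F where "F = free_nilpotent_group {a, b} 3"
  define x where "x = free_nilpotent_gen {a, b} 3 a"
  define y where "y = free_nilpotent_gen {a, b} 3 b"
  interpret F: group F unfolding F_def by (rule free_nilpotent_group_is_group)
  have xy: "x \<in> carrier F" "y \<in> carrier F"
    unfolding F_def x_def y_def by (simp_all add: free_nilpotent_gen_closed)
  have nilp: "lower_central F 4 = {\<one>\<^bsub>F\<^esub>}"
    using free_nilpotent_class[of "{a, b}" 3] by (simp add: F_def numeral_eq_Suc)
  have gen: "generate F {x, y} = carrier F"
    using free_nilpotent_generated[of "{a, b}" 3] by (simp add: F_def x_def y_def)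
  have endo: "\<exists>\<theta>\<in>hom F F. \<theta> x = u \<and> \<theta> y = v" if "u \<in> carrier F" "v \<in> carrier F" for u v
  proof -
    show ?thesis
      using free_nilpotent_universal_pair[OF assms(1) F.is_group _ that, of 3] nilp
      by (simp add: F_def x_def y_def numeral_eq_Suc)
  qed
  obtain e where e: "e \<in> hom F shift_group" "e x = (1, 0, 0, 0)" "e y = (0, 1, 0, 0)"
    using free_nilpotent_universal_pair[OF assms(1) group_shift_group,
        of 3 "(1, 0, 0, 0)" "(0, 1, 0, 0)"] shift_group_class
    by (auto simp: F_def x_def y_def numeral_eq_Suc)
  interpret free_class_three_prime F x y e p
    by unfold_locales
      (use xy nilp gen endo e assms in auto)
  have orbits: "(\<exists>Orb\<in>orbits (AutoGroup F) {H. subgroup H F} (aut_action F). N r \<in> Orb \<and> N s \<in> Orb)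
      \<longleftrightarrow> r = s \<or> r = p - s" (is "?orb \<longleftrightarrow> _")
    if r: "r \<in> {1..p-1}" and s: "s \<in> {1..p-1}" for r s
  proof -
    have "?orb \<longleftrightarrow> (\<exists>\<phi>\<in>iso F F. \<phi> ` N r = N s)"
      by (rule F.same_aut_orbit_iff) (simp_all add: normal_imp_subgroup N_normal)
    also have "\<dots> \<longleftrightarrow> r = s \<or> r = p - s"
    proof
      assume "\<exists>\<phi>\<in>iso F F. \<phi> ` N r = N s"
      then show "r = s \<or> r = p - s" using same_orbit_imp[OF r s] by blast
    next
      assume "r = s \<or> r = p - s"
      then consider "r = s" | "s = p - r" using s by fastforce
      then show "\<exists>\<phi>\<in>iso F F. \<phi> ` N r = N s"
      proof cases
        case 1
        then show ?thesis using id_iso[of F] by (auto intro!: bexI[of _ id])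
      next
        case 2
        then show ?thesis using opposite_same_orbit[OF r] by simp
      qed
    qed
    finally show ?thesis .
  qed
  show ?thesis
    unfolding Let_def F_def[symmetric] x_def[symmetric] y_def[symmetric]
    using quotient_p_group quotient_order quotient_has_class_3 quotient_exponent
      quotients_isomorphic orbits
    by (simp add: order_def)
qed

end
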